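(* Let $S$ be a $\mathscr D$-cancellative Boolean inverse semigroup, let $n$ be a positive integer, let $G$ be a group, and let $\varphi\colon S\twoheadrightarrow\mathrm M^{\oplus}_n(G^{\sqcup0})$ be a surjective bias homomorphism. Then there are a group $\overline G$, a surjective group homomorphism $\psi\colon\overline G\twoheadrightarrow G$, and a bias embedding $\eta\colon\mathrm M^{\oplus}_n(\overline G^{\sqcup0})\hookrightarrow S$ such that $\mathrm M^{\oplus}_n(\psi^{\sqcup0})=\varphi\circ\eta$.
   Context: A semigroup $S$ is inverse if every $x\in S$ has a unique $x^{-1}$ with $x=xx^{-1}x$ and $x^{-1}=x^{-1}xx^{-1}$. Put $\mathbf d(x)=x^{-1}x$, $\mathbf r(x)=xx^{-1}$; $\operatorname{Idp}S$ is the set of idempotents; the natural ordering is $x\le y$ iff $x=y\,\mathbf d(x)$. In an inverse semigroup with zero, $x\perp y$ (orthogonality) means $x^{-1}y=xy^{-1}=0$. A Boolean inverse semigroup is an inverse semigroup $S$ with zero such that $\operatorname{Idp}S$ is a generalized Boolean algebra and any two orthogonal $x,y$ have a join $x\oplus y$ for the natural ordering. A bias is the same as a Boolean inverse semigroup (viewed as an algebra in a suitable variety), and bias homomorphisms are exactly the semigroup homomorphisms $f$ with $f(0)=0$ and $f(x\oplus y)=f(x)\oplus f(y)$ for orthogonal $x,y$; a bias embedding is a one-to-one bias homomorphism. For $a,b\in\operatorname{Idp}S$, $a\mathscr D b$ means that there is $x\in S$ with $\mathbf d(x)=a$ and $\mathbf r(x)=b$. $S$ is $\mathscr D$-cancellative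 if for all $a,b,a',b'\in\operatorname{Idp}S$ with $a\perp b$ and $a'\perp b'$, the conditions $a\oplus b=a'\oplus b'$ and $a\mathscr D a'$ imply $b\mathscr D b'$. For a Boolean inverse semigroup $S$, a generalized rook matrix of order $n$ over $S$ is a matrix $(x_{i,j})_{1\le i,j\le n}$ over $S$ with $x_{i,j}^{-1}x_{i,k}=x_{j,i}x_{k,i}^{-1}=0$ whenever $j\ne k$; these form a Boolean inverse semigroup $\mathrm M^{\oplus}_n(S)$ under $(xy)_{i,j}=\bigoplus_kx_{i,k}y_{k,j}$. For a group $G$, $G^{\sqcup0}=G\cup\{0\}$ is $G$ with a new zero; for a group homomorphism $\psi\colon\overline G\to G$, $\psi^{\sqcup0}\colon\overline G^{\sqcup0}\to G^{\sqcup0}$ extends $\psi$ by $0\mapsto0$. For a bias homomorphism $f\colon S\to T$, $\mathrm M^{\oplus}_n(f)\colon\mathrm M^{\oplus}_n(S)\to\mathrm M^{\oplus}_n(T)$ applies $f$ entrywise. *)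

theory Defs
  imports "HOL-Algebra.Group" "HOL-Algebra.Lattice" "Jordan_Normal_Form.Matrix"
begin

section \<open>Inverse semigroups with zero\<close>

text \<open>HOL-Algebra has records for monoids but not for semigroups; the semigroups considered here
  have no unit in general.\<close>

record 'a semigroup_zero = "'a partial_object" +
  sg_mult :: "'a \<Rightarrow> 'a \<Rightarrow> 'a" (infixl \<open>\<cdot>\<index>\<close> 70)
  sg_zero :: 'a

definition is_inverse :: "('a, 'm) semigroup_zero_scheme \<Rightarrow> 'a \<Rightarrow> 'a \<Rightarrow> bool" where
  "is_inverse S x y \<longleftrightarrow>
     y \<in> carrier S \<and> x = x \<cdot>\<^bsub>S\<^esub> y \<cdot>\<^bsub>S\<^esub> x \<and> y = y \<cdot>\<^bsub>S\<^esub> x \<cdot>\<^bsub>S\<^esub> y"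

definition sg_inv :: "('a, 'm) semigroup_zero_scheme \<Rightarrow> 'a \<Rightarrow> 'a" where
  "sg_inv S x = (THE y. is_inverse S x y)"

locale inverse_semigroup_zero =
  fixes S (structure)
  assumes mult_closed: "\<lbrakk>x \<in> carrier S; y \<in> carrier S\<rbrakk> \<Longrightarrow> x \<cdot> y \<in> carrier S"
    and mult_assoc: "\<lbrakk>x \<in> carrier S; y \<in> carrier S; z \<in> carrier S\<rbrakk> \<Longrightarrow> (x \<cdot> y) \<cdot> z = x \<cdot> (y \<cdot> z)"
    and unique_inverse: "x \<in> carrier S \<Longrightarrow> \<exists>!y. is_inverse S x y"
    and zero_closed: "sg_zero S \<in> carrier S"
    and zero_left: "x \<in> carrier S \<Longrightarrow> sg_zero S \<cdot> x = sg_zero S"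
    and zero_right: "x \<in> carrier S \<Longrightarrow> x \<cdot> sg_zero S = sg_zero S"

definition sg_dom :: "('a, 'm) semigroup_zero_scheme \<Rightarrow> 'a \<Rightarrow> 'a" where
  "sg_dom S x = sg_inv S x \<cdot>\<^bsub>S\<^esub> x"

definition sg_ran :: "('a, 'm) semigroup_zero_scheme \<Rightarrow> 'a \<Rightarrow> 'a" where
  "sg_ran S x = x \<cdot>\<^bsub>S\<^esub> sg_inv S x"

definition Idp :: "('a, 'm) semigroup_zero_scheme \<Rightarrow> 'a set" where
  "Idp S = {e \<in> carrier S. e \<cdot>\<^bsub>S\<^esub> e = e}"

definition nat_le :: "('a, 'm) semigroup_zero_scheme \<Rightarrow> 'a \<Rightarrow> 'a \<Rightarrow> bool" where
  "nat_le S x y \<longleftrightarrow> x = y \<cdot>\<^bsub>S\<^esub> sg_dom S x"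

definition nat_order :: "('a, 'm) semigroup_zero_scheme \<Rightarrow> 'a gorder" where
  "nat_order S = \<lparr>carrier = carrier S, eq = (=), le = nat_le S\<rparr>"

definition Idp_order :: "('a, 'm) semigroup_zero_scheme \<Rightarrow> 'a gorder" where
  "Idp_order S = \<lparr>carrier = Idp S, eq = (=), le = nat_le S\<rparr>"

definition orth :: "('a, 'm) semigroup_zero_scheme \<Rightarrow> 'a \<Rightarrow> 'a \<Rightarrow> bool" where
  "orth S x y \<longleftrightarrow> sg_inv S x \<cdot>\<^bsub>S\<^esub> y = sg_zero S \<and> x \<cdot>\<^bsub>S\<^esub> sg_inv S y = sg_zero S"

text \<open>Joins are taken in all of \<open>S\<close>. They are meaningful only where they exist, in
  particular for (finite sets of pairwise) orthogonal elements of a Boolean inverse semigroup.\<close>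

definition orth_join :: "('a, 'm) semigroup_zero_scheme \<Rightarrow> 'a \<Rightarrow> 'a \<Rightarrow> 'a" where
  "orth_join S x y = x \<squnion>\<^bsub>nat_order S\<^esub> y"

definition orth_Join :: "('a, 'm) semigroup_zero_scheme \<Rightarrow> 'i set \<Rightarrow> ('i \<Rightarrow> 'a) \<Rightarrow> 'a" where
  "orth_Join S I x = \<Squnion>\<^bsub>nat_order S\<^esub>(x ` I)"


section \<open>Boolean inverse semigroups\<close>

text \<open>A generalized Boolean algebra is a distributive lattice with least element in which
  relative complements exist; a greatest element is not required.\<close>

locale generalized_boolean_algebra = lattice + weak_partial_order_bottom +
  assumes meet_join_distrib:
      "\<lbrakk>x \<in> carrier L; y \<in> carrier L; z \<in> carrier L\<rbrakk> \<Longrightarrow> x \<sqinter> (y \<squnion> z) = (x \<sqinter> y) \<squnion> (x \<sqinter> z)"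
    and relative_complement:
      "\<lbrakk>x \<in> carrier L; y \<in> carrier L; x \<sqsubseteq> y\<rbrakk> \<Longrightarrow> \<exists>z\<in>carrier L. x \<sqinter> z = \<bottom> \<and> x \<squnion> z = y"

locale boolean_inverse_semigroup = inverse_semigroup_zero +
  assumes Idp_gba: "generalized_boolean_algebra (Idp_order S)"
    and orth_join_exists:
      "\<lbrakk>x \<in> carrier S; y \<in> carrier S; orth S x y\<rbrakk>
        \<Longrightarrow> \<exists>z. least (nat_order S) z (Upper (nat_order S) {x, y})"

definition bias_hom ::
  "('a, 'm) semigroup_zero_scheme \<Rightarrow> ('b, 'k) semigroup_zero_scheme \<Rightarrow> ('a \<Rightarrow> 'b) set" where
  "bias_hom S T = {f \<in> carrier S \<rightarrow> carrier T.
     (\<forall>x\<in>carrier S. \<forall>y\<in>carrier S. f (x \<cdot>\<^bsub>S\<^esub> y) = f x \<cdot>\<^bsub>T\<^esub> f y) \<and>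
     f (sg_zero S) = sg_zero T \<and>
     (\<forall>x\<in>carrier S. \<forall>y\<in>carrier S. orth S x y \<longrightarrow> f (orth_join S x y) = orth_join T (f x) (f y))}"

definition bias_embedding ::
  "('a, 'm) semigroup_zero_scheme \<Rightarrow> ('b, 'k) semigroup_zero_scheme \<Rightarrow> ('a \<Rightarrow> 'b) set" where
  "bias_embedding S T = {f \<in> bias_hom S T. inj_on f (carrier S)}"

definition D_rel :: "('a, 'm) semigroup_zero_scheme \<Rightarrow> 'a \<Rightarrow> 'a \<Rightarrow> bool" where
  "D_rel S a b \<longleftrightarrow> (\<exists>x\<in>carrier S. sg_dom S x = a \<and> sg_ran S x = b)"

definition D_cancellative :: "('a, 'm) semigroup_zero_scheme \<Rightarrow> bool" where
  "D_cancellative S \<longleftrightarrow>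
     (\<forall>a\<in>Idp S. \<forall>b\<in>Idp S. \<forall>a'\<in>Idp S. \<forall>b'\<in>Idp S.
        orth S a b \<longrightarrow> orth S a' b' \<longrightarrow>
        orth_join S a b = orth_join S a' b' \<longrightarrow> D_rel S a a' \<longrightarrow> D_rel S b b')"


section \<open>Generalized rook matrices and groups with zero\<close>

text \<open>Rows and columns are indexed by \<open>0, \<dots>, n - 1\<close>. The map induced on matrices by \<open>f\<close>,
  applied entrywise, is \<open>map_mat f\<close>.\<close>

definition rook_matrices :: "nat \<Rightarrow> ('a, 'm) semigroup_zero_scheme \<Rightarrow> 'a mat set" where
  "rook_matrices n S = {A \<in> carrier_mat n n.
     (\<forall>i<n. \<forall>j<n. A $$ (i, j) \<in> carrier S) \<and>
     (\<forall>i<n. \<forall>j<n. \<forall>k<n. j \<noteq> k \<longrightarrow>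
        sg_inv S (A $$ (i, j)) \<cdot>\<^bsub>S\<^esub> A $$ (i, k) = sg_zero S \<and>
        A $$ (j, i) \<cdot>\<^bsub>S\<^esub> sg_inv S (A $$ (k, i)) = sg_zero S)}"

definition rook_mat :: "nat \<Rightarrow> ('a, 'm) semigroup_zero_scheme \<Rightarrow> 'a mat semigroup_zero" where
  "rook_mat n S =
     \<lparr>carrier = rook_matrices n S,
      sg_mult = (\<lambda>A B. mat n n (\<lambda>(i, j).
        orth_Join S {..<n} (\<lambda>k. A $$ (i, k) \<cdot>\<^bsub>S\<^esub> B $$ (k, j)))),
      sg_zero = mat n n (\<lambda>_. sg_zero S)\<rparr>"

text \<open>The new zero is \<open>None\<close>; the extension of a homomorphism \<open>\<psi>\<close> by \<open>0 \<mapsto> 0\<close> is therefore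
  \<open>map_option \<psi>\<close>.\<close>

definition group_zero :: "('g, 'm) monoid_scheme \<Rightarrow> 'g option semigroup_zero" where
  "group_zero G =
     \<lparr>carrier = insert None (Some ` carrier G),
      sg_mult = (\<lambda>x y. case (x, y) of (Some g, Some h) \<Rightarrow> Some (g \<otimes>\<^bsub>G\<^esub> h) | _ \<Rightarrow> None),
      sg_zero = None\<rparr>"

end

theory Submission
  imports Defs
begin

text \<open>
Let \<open>E i j\<close> be the matrix units over \<open>G\<close>. The point is to find in \<open>S\<close> an idempotent \<open>e\<close> and elements
\<open>f\<^sub>0, \<dots>, f\<^sub>n\<^sub>-\<^sub>1\<close> with domain \<open>e\<close> and pairwise orthogonal ranges, such that \<open>\<phi>\<close> sends \<open>e\<close> to \<open>E 0 0\<close> and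
\<open>f\<^sub>i\<close> to \<open>E i 0\<close> (\<open>matrix_frame_lifts\<close>). Since \<open>\<phi>\<close> is onto, the diagonal units come from idempotents
of \<open>S\<close>; the overlaps of these are sent to zero and can be removed by passing to relative complements,
because \<open>\<phi>\<close> respects orthogonal joins. The resulting orthogonal idempotents cut preimages of the
\<open>E i 0\<close>, and finally everything is restricted to the meet of the domains.

The group asked for is the maximal subgroup at \<open>e\<close>, that is, the elements whose domain and range are
both \<open>e\<close>. The embedding sends a rook matrix \<open>A\<close> over it to the join of the orthogonal elements
\<open>f\<^sub>i A\<^sub>i\<^sub>j f\<^sub>j\<^sup>-\<^sup>1\<close>, and \<open>\<psi>\<close> reads off the entry \<open>(0, 0)\<close> of the image under \<open>\<phi>\<close>. An element
of \<open>S\<close> is probed by its compressions \<open>f\<^sub>i\<^sup>-\<^sup>1 s f\<^sub>j\<close>, and the compression of the image of \<open>A\<close> is the entry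
\<open>A\<^sub>i\<^sub>j\<close> again (\<open>embed_entry\<close>). This one formula shows that the embedding is injective and
that applying \<open>\<phi>\<close> after it amounts to applying \<open>\<psi>\<close> to the entries.

Cancellativity serves to show that \<open>\<psi>\<close> is onto (\<open>max_subgroup_onto\<close>). A preimage
of a group element, compressed by \<open>e\<close>, is only a partial bijection of \<open>e\<close>, defined off a part that \<open>\<phi>\<close>
annihilates. Its domain and range have equivalent complements in \<open>e\<close>, so it can be completed by an
element of the kernel.

The technical problem is that multiplication must be shown to distribute over joins. Instead of
joins, the proofs use a density condition (\<open>covers\<close>) that passes to products by a short computation and
agrees with being the join as soon as a join exists (\<open>is_join_covers\<close>, \<open>covers_eq_join\<close>).
\<close>

section \<open>Inverses and idempotents\<close>

text \<open>In a semigroup whose idempotents commute, two inverses \<open>y\<close>, \<open>z\<close> of \<open>x\<close> both equal \<open>z x y\<close>: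
expand \<open>y = y x y\<close> to \<open>(y x)(z x) y\<close>, or \<open>z = z x z\<close> to \<open>z (x y)(x z)\<close>, and swap the two idempotents.
This is how the semigroup of rook matrices is recognised as inverse below.\<close>

lemma inverse_unique_if_Idp_commute:
  assumes cl: "\<And>x y. x \<in> carrier S \<Longrightarrow> y \<in> carrier S \<Longrightarrow> x \<cdot>\<^bsub>S\<^esub> y \<in> carrier S"
    and as: "\<And>x y z. x \<in> carrier S \<Longrightarrow> y \<in> carrier S \<Longrightarrow> z \<in> carrier S \<Longrightarrow>
      (x \<cdot>\<^bsub>S\<^esub> y) \<cdot>\<^bsub>S\<^esub> z = x \<cdot>\<^bsub>S\<^esub> (y \<cdot>\<^bsub>S\<^esub> z)"
    and comm: "\<And>e f. e \<in> Idp S \<Longrightarrow> f \<in> Idp S \<Longrightarrow> e \<cdot>\<^bsub>S\<^esub> f = f \<cdot>\<^bsub>S\<^esub> e"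
    and x: "x \<in> carrier S" and y: "is_inverse S x y" and z: "is_inverse S x z"
  shows "y = z"
proof -
  note [simp] = cl as x
  have [simp]: "y \<in> carrier S" "z \<in> carrier S" using y z by (auto simp: is_inverse_def)
  have y1: "x \<cdot>\<^bsub>S\<^esub> (y \<cdot>\<^bsub>S\<^esub> x) = x" "y \<cdot>\<^bsub>S\<^esub> (x \<cdot>\<^bsub>S\<^esub> y) = y"
    and z1: "x \<cdot>\<^bsub>S\<^esub> (z \<cdot>\<^bsub>S\<^esub> x) = x" "z \<cdot>\<^bsub>S\<^esub> (x \<cdot>\<^bsub>S\<^esub> z) = z"
    using y z unfolding is_inverse_def by (metis as x)+
  have I: "y \<cdot>\<^bsub>S\<^esub> x \<in> Idp S" "z \<cdot>\<^bsub>S\<^esub> x \<in> Idp S" "x \<cdot>\<^bsub>S\<^esub> y \<in> Idp S" "x \<cdot>\<^bsub>S\<^esub> z \<in> Idp S"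
    by (simp_all add: Idp_def y1 z1)
  have "y = y \<cdot>\<^bsub>S\<^esub> (x \<cdot>\<^bsub>S\<^esub> (z \<cdot>\<^bsub>S\<^esub> x)) \<cdot>\<^bsub>S\<^esub> y" by (simp only: z1) (simp add: y1)
  also have "\<dots> = ((y \<cdot>\<^bsub>S\<^esub> x) \<cdot>\<^bsub>S\<^esub> (z \<cdot>\<^bsub>S\<^esub> x)) \<cdot>\<^bsub>S\<^esub> y" by simp
  also have "\<dots> = ((z \<cdot>\<^bsub>S\<^esub> x) \<cdot>\<^bsub>S\<^esub> (y \<cdot>\<^bsub>S\<^esub> x)) \<cdot>\<^bsub>S\<^esub> y" by (simp only: comm[OF I(1,2)])
  also have "\<dots> = z \<cdot>\<^bsub>S\<^esub> (x \<cdot>\<^bsub>S\<^esub> y)" by (simp add: y1)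
  also have "\<dots> = (z \<cdot>\<^bsub>S\<^esub> (x \<cdot>\<^bsub>S\<^esub> z)) \<cdot>\<^bsub>S\<^esub> (x \<cdot>\<^bsub>S\<^esub> y)" by (simp only: z1)
  also have "\<dots> = z \<cdot>\<^bsub>S\<^esub> ((x \<cdot>\<^bsub>S\<^esub> z) \<cdot>\<^bsub>S\<^esub> (x \<cdot>\<^bsub>S\<^esub> y))" by simp
  also have "\<dots> = z \<cdot>\<^bsub>S\<^esub> ((x \<cdot>\<^bsub>S\<^esub> y) \<cdot>\<^bsub>S\<^esub> (x \<cdot>\<^bsub>S\<^esub> z))" by (simp only: comm[OF I(3,4)])
  also have "\<dots> = z \<cdot>\<^bsub>S\<^esub> ((x \<cdot>\<^bsub>S\<^esub> (y \<cdot>\<^bsub>S\<^esub> x)) \<cdot>\<^bsub>S\<^esub> z)" by simp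
  also have "\<dots> = z" by (simp only: y1) (rule z1)
  finally show ?thesis .
qed

lemma orth_join_commute: "orth_join S x y = orth_join S y x"
  by (simp add: orth_join_def join_def insert_commute)

context inverse_semigroup_zero
begin

abbreviation inverse_elt ("_\<^sup>\<star>" [1000] 999) where "x\<^sup>\<star> \<equiv> sg_inv S x"
abbreviation zero_elt ("\<^bold>0") where "\<^bold>0 \<equiv> sg_zero S"
abbreviation natural_le (infix "\<preceq>" 50) where "x \<preceq> y \<equiv> nat_le S x y"

lemma Idp_carrier [simp]: "e \<in> Idp S \<Longrightarrow> e \<in> carrier S"
  by (simp add: Idp_def)

lemma Idp_idem [simp]: "e \<in> Idp S \<Longrightarrow> e \<cdot> e = e"
  unfolding Idp_def by blast

lemma IdpI: "\<lbrakk>e \<in> carrier S; e \<cdot> e = e\<rbrakk> \<Longrightarrow> e \<in> Idp S"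
  unfolding Idp_def by blast

declare mult_closed [simp, intro] mult_assoc [simp] zero_closed [simp, intro]
  zero_left [simp] zero_right [simp]

lemma is_inverse_inv: "x \<in> carrier S \<Longrightarrow> is_inverse S x (x\<^sup>\<star>)"
  unfolding sg_inv_def using unique_inverse by (rule theI')

lemma inv_eqI: "\<lbrakk>x \<in> carrier S; is_inverse S x y\<rbrakk> \<Longrightarrow> x\<^sup>\<star> = y"
  using is_inverse_inv unique_inverse by blast

lemma inv_closed [simp, intro]: "x \<in> carrier S \<Longrightarrow> x\<^sup>\<star> \<in> carrier S"
  using is_inverse_inv by (simp add: is_inverse_def)

lemma mult_inv_mult [simp]: "x \<in> carrier S \<Longrightarrow> x \<cdot> (x\<^sup>\<star> \<cdot> x) = x"
  using is_inverse_inv[of x] by (auto simp: is_inverse_def)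

lemma inv_mult_inv [simp]: "x \<in> carrier S \<Longrightarrow> x\<^sup>\<star> \<cdot> (x \<cdot> x\<^sup>\<star>) = x\<^sup>\<star>"
  using is_inverse_inv[of x] by (auto simp: is_inverse_def)

lemma mult_inv_mult' [simp]: "\<lbrakk>x \<in> carrier S; y \<in> carrier S\<rbrakk> \<Longrightarrow> x \<cdot> (x\<^sup>\<star> \<cdot> (x \<cdot> y)) = x \<cdot> y"
  by (metis mult_inv_mult mult_assoc inv_closed mult_closed)

lemma inv_mult_inv' [simp]: "\<lbrakk>x \<in> carrier S; y \<in> carrier S\<rbrakk> \<Longrightarrow> x\<^sup>\<star> \<cdot> (x \<cdot> (x\<^sup>\<star> \<cdot> y)) = x\<^sup>\<star> \<cdot> y"
  by (metis inv_mult_inv mult_assoc inv_closed mult_closed)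

lemma inv_inv [simp]: "x \<in> carrier S \<Longrightarrow> (x\<^sup>\<star>)\<^sup>\<star> = x"
  by (rule inv_eqI) (auto simp: is_inverse_def)

lemma inv_zero [simp]: "\<^bold>0\<^sup>\<star> = \<^bold>0"
  by (rule inv_eqI) (auto simp: is_inverse_def)

lemma Idp_idem' [simp]: "\<lbrakk>e \<in> Idp S; x \<in> carrier S\<rbrakk> \<Longrightarrow> e \<cdot> (e \<cdot> x) = e \<cdot> x"
  using mult_assoc[of e e x, symmetric] by (simp del: mult_assoc)

lemma Idp_inv [simp]: "e \<in> Idp S \<Longrightarrow> e\<^sup>\<star> = e"
  by (rule inv_eqI) (auto simp: is_inverse_def)

lemma zero_Idp [simp]: "\<^bold>0 \<in> Idp S"
  by (rule IdpI) simp_all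

text \<open>If \<open>x\<close> is the inverse of \<open>e f\<close>, then \<open>f x e\<close> is also one, so \<open>x = f x e\<close> is idempotent and
hence its own inverse; by uniqueness \<open>e f = x\<close>.\<close>

lemma Idp_mult [simp, intro]:
  assumes e: "e \<in> Idp S" and f: "f \<in> Idp S"
  shows "e \<cdot> f \<in> Idp S"
proof -
  define x where "x = (e \<cdot> f)\<^sup>\<star>"
  have [simp]: "e \<in> carrier S" "f \<in> carrier S" "x \<in> carrier S" using e f by (simp_all add: x_def)
  have inv: "(e \<cdot> f) \<cdot> (x \<cdot> (e \<cdot> f)) = e \<cdot> f" "x \<cdot> ((e \<cdot> f) \<cdot> x) = x"
    unfolding x_def by (simp_all del: mult_assoc)
  have x: "x = f \<cdot> (x \<cdot> e)"
    unfolding x_def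
  proof (rule inv_eqI)
    have "(f \<cdot> (x \<cdot> e)) \<cdot> ((e \<cdot> f) \<cdot> (f \<cdot> (x \<cdot> e))) = f \<cdot> ((x \<cdot> ((e \<cdot> f) \<cdot> x)) \<cdot> e)"
      using e f by simp
    then have "(f \<cdot> (x \<cdot> e)) \<cdot> ((e \<cdot> f) \<cdot> (f \<cdot> (x \<cdot> e))) = f \<cdot> (x \<cdot> e)" by (simp only: inv)
    then show "is_inverse S (e \<cdot> f) (f \<cdot> ((e \<cdot> f)\<^sup>\<star> \<cdot> e))"
      using e f inv unfolding is_inverse_def x_def[symmetric] by simp
  qed simp
  have "x \<cdot> x = (f \<cdot> (x \<cdot> e)) \<cdot> (f \<cdot> (x \<cdot> e))" by (rule arg_cong2[OF x x])
  also have "\<dots> = f \<cdot> ((x \<cdot> ((e \<cdot> f) \<cdot> x)) \<cdot> e)" by simp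
  also have "\<dots> = x" by (simp only: inv) (rule x[symmetric])
  finally have "x \<in> Idp S" by (rule IdpI[rotated]) simp
  then have "x\<^sup>\<star> = x" by simp
  then show ?thesis using \<open>x \<in> Idp S\<close> by (simp add: x_def)
qed

text \<open>Once products of idempotents are idempotent, \<open>f e\<close> is an inverse of the idempotent \<open>e f\<close>,
whose only inverse is itself.\<close>

lemma Idp_commute:
  assumes e: "e \<in> Idp S" and f: "f \<in> Idp S"
  shows "e \<cdot> f = f \<cdot> e"
proof -
  have 1: "e \<cdot> (f \<cdot> (e \<cdot> f)) = e \<cdot> f" "f \<cdot> (e \<cdot> (f \<cdot> e)) = f \<cdot> e"
    using Idp_idem[OF Idp_mult[OF e f]] Idp_idem[OF Idp_mult[OF f e]] e f
    by (simp_all del: Idp_idem)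
  have "(e \<cdot> f)\<^sup>\<star> = f \<cdot> e"
  proof (rule inv_eqI)
    show "is_inverse S (e \<cdot> f) (f \<cdot> e)" using e f 1 by (simp add: is_inverse_def)
  qed (use e f in simp)
  then show ?thesis using Idp_mult[OF e f] by simp
qed

lemma Idp_left_commute:
  "\<lbrakk>e \<in> Idp S; f \<in> Idp S; x \<in> carrier S\<rbrakk> \<Longrightarrow> e \<cdot> (f \<cdot> x) = f \<cdot> (e \<cdot> x)"
  by (metis Idp_commute Idp_carrier mult_assoc)

lemma inv_mult_Idp [simp, intro]: "x \<in> carrier S \<Longrightarrow> x\<^sup>\<star> \<cdot> x \<in> Idp S"
  by (rule IdpI) simp_all

lemma mult_inv_Idp [simp, intro]: "x \<in> carrier S \<Longrightarrow> x \<cdot> x\<^sup>\<star> \<in> Idp S"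
  by (rule IdpI) simp_all

lemma inv_mult [simp]:
  assumes "x \<in> carrier S" and "y \<in> carrier S"
  shows "(x \<cdot> y)\<^sup>\<star> = y\<^sup>\<star> \<cdot> x\<^sup>\<star>"
proof (rule inv_eqI)
  have *: "(y \<cdot> y\<^sup>\<star>) \<cdot> (x\<^sup>\<star> \<cdot> x) = (x\<^sup>\<star> \<cdot> x) \<cdot> (y \<cdot> y\<^sup>\<star>)"
    using assms by (intro Idp_commute) auto
  have "x \<cdot> y \<cdot> (y\<^sup>\<star> \<cdot> x\<^sup>\<star>) \<cdot> (x \<cdot> y) = x \<cdot> ((y \<cdot> y\<^sup>\<star>) \<cdot> (x\<^sup>\<star> \<cdot> x)) \<cdot> y" using assms by simp
  also have "\<dots> = x \<cdot> y" unfolding * using assms by simp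
  moreover have "y\<^sup>\<star> \<cdot> x\<^sup>\<star> \<cdot> (x \<cdot> y) \<cdot> (y\<^sup>\<star> \<cdot> x\<^sup>\<star>) = y\<^sup>\<star> \<cdot> ((x\<^sup>\<star> \<cdot> x) \<cdot> (y \<cdot> y\<^sup>\<star>)) \<cdot> x\<^sup>\<star>"
    using assms by simp
  moreover have "\<dots> = y\<^sup>\<star> \<cdot> x\<^sup>\<star>" unfolding *[symmetric] using assms by simp
  ultimately show "is_inverse S (x \<cdot> y) (y\<^sup>\<star> \<cdot> x\<^sup>\<star>)" using assms by (simp add: is_inverse_def)
qed (use assms in simp)

lemma conj_Idp [simp]:
  assumes "x \<in> carrier S" "e \<in> Idp S"
  shows "x \<cdot> (e \<cdot> x\<^sup>\<star>) \<in> Idp S" "x\<^sup>\<star> \<cdot> (e \<cdot> x) \<in> Idp S"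
  using assms mult_inv_Idp[of "x \<cdot> e"] inv_mult_Idp[of "e \<cdot> x"] by simp_all

section \<open>The natural order\<close>

lemma nat_le_iff: "x \<preceq> y \<longleftrightarrow> x = y \<cdot> (x\<^sup>\<star> \<cdot> x)"
  by (simp add: nat_le_def sg_dom_def)

lemma nat_le_mult_Idp [simp]:
  assumes "y \<in> carrier S" "e \<in> Idp S" shows "y \<cdot> e \<preceq> y"
  using assms Idp_left_commute[of e "y\<^sup>\<star> \<cdot> y" e] by (simp add: nat_le_iff)

text \<open>An idempotent can be moved across an element at the price of conjugating it. This makes the
natural order, defined by restricting domains, also expressible by restricting ranges.\<close>

lemma Idp_push: "\<lbrakk>y \<in> carrier S; e \<in> Idp S\<rbrakk> \<Longrightarrow> e \<cdot> y = y \<cdot> (y\<^sup>\<star> \<cdot> (e \<cdot> y))"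
  using Idp_left_commute[of e "y \<cdot> y\<^sup>\<star>" y] by simp

lemma Idp_push': "\<lbrakk>y \<in> carrier S; e \<in> Idp S\<rbrakk> \<Longrightarrow> y \<cdot> e = (y \<cdot> (e \<cdot> y\<^sup>\<star>)) \<cdot> y"
  using Idp_commute[of e "y\<^sup>\<star> \<cdot> y"] by simp

lemma nat_le_Idp_mult [simp]: "\<lbrakk>y \<in> carrier S; e \<in> Idp S\<rbrakk> \<Longrightarrow> e \<cdot> y \<preceq> y"
  using nat_le_mult_Idp[of y "y\<^sup>\<star> \<cdot> (e \<cdot> y)"] Idp_push[of y e] by simp

lemma nat_leE:
  assumes "x \<preceq> y" "x \<in> carrier S" "y \<in> carrier S"
  obtains e where "e \<in> Idp S" "x = y \<cdot> e"
  using assms unfolding nat_le_iff by blast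

lemma nat_le_ran:
  assumes "x \<preceq> y" and [simp]: "x \<in> carrier S" "y \<in> carrier S"
  shows "x \<cdot> (x\<^sup>\<star> \<cdot> y) = x"
proof -
  obtain e where e [simp]: "e \<in> Idp S" "x = y \<cdot> e" by (rule nat_leE[OF assms])
  define f where "f = y \<cdot> (e \<cdot> y\<^sup>\<star>)"
  have [simp]: "f \<in> Idp S" by (simp add: f_def)
  have x: "x = f \<cdot> y" unfolding f_def using Idp_push'[of y e] by simp
  have "x \<cdot> (x\<^sup>\<star> \<cdot> y) = f \<cdot> ((y \<cdot> y\<^sup>\<star>) \<cdot> (f \<cdot> y))" unfolding x by simp
  also have "\<dots> = f \<cdot> (f \<cdot> ((y \<cdot> y\<^sup>\<star>) \<cdot> y))" by (subst Idp_left_commute) simp_all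
  also have "\<dots> = x" unfolding x by simp
  finally show ?thesis .
qed

lemma nat_le_dom:
  "\<lbrakk>x \<preceq> y; x \<in> carrier S; y \<in> carrier S\<rbrakk> \<Longrightarrow> y \<cdot> (x\<^sup>\<star> \<cdot> x) = x"
  by (simp add: nat_le_iff)

lemma nat_le_refl [simp]: "x \<in> carrier S \<Longrightarrow> x \<preceq> x"
  by (simp add: nat_le_iff)

lemma nat_le_trans:
  "\<lbrakk>x \<preceq> y; y \<preceq> z; x \<in> carrier S; y \<in> carrier S; z \<in> carrier S\<rbrakk> \<Longrightarrow> x \<preceq> z"
  by (elim nat_leE[of x y] nat_leE[of y z]) (simp_all add: Idp_mult)

lemma nat_le_antisym:
  assumes "x \<preceq> y" "y \<preceq> x" and [simp]: "x \<in> carrier S" "y \<in> carrier S"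
  shows "x = y"
proof -
  have "x = y \<cdot> (x\<^sup>\<star> \<cdot> x)" "y = x \<cdot> (y\<^sup>\<star> \<cdot> y)" using assms by (simp_all add: nat_le_dom)
  then have "x = x \<cdot> ((y\<^sup>\<star> \<cdot> y) \<cdot> (x\<^sup>\<star> \<cdot> x))" by (metis mult_assoc inv_closed mult_closed assms(3,4))
  also have "\<dots> = (x \<cdot> (x\<^sup>\<star> \<cdot> x)) \<cdot> (y\<^sup>\<star> \<cdot> y)" by (subst Idp_commute) simp_all
  also have "\<dots> = x \<cdot> (y\<^sup>\<star> \<cdot> y)" by simp
  also have "\<dots> = y" using \<open>y = x \<cdot> (y\<^sup>\<star> \<cdot> y)\<close> by (rule sym)
  finally show ?thesis .
qed

lemma zero_nat_le [simp]: "x \<in> carrier S \<Longrightarrow> \<^bold>0 \<preceq> x"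
  by (simp add: nat_le_iff)

lemma nat_le_zero: "\<lbrakk>x \<preceq> \<^bold>0; x \<in> carrier S\<rbrakk> \<Longrightarrow> x = \<^bold>0"
  by (simp add: nat_le_iff)

lemma nat_le_mult_left:
  "\<lbrakk>x \<preceq> y; x \<in> carrier S; y \<in> carrier S; u \<in> carrier S\<rbrakk> \<Longrightarrow> u \<cdot> x \<preceq> u \<cdot> y"
  by (metis nat_leE nat_le_mult_Idp mult_assoc Idp_carrier mult_closed)

lemma nat_le_mult_right:
  assumes "x \<preceq> y" and [simp]: "x \<in> carrier S" "y \<in> carrier S" "u \<in> carrier S"
  shows "x \<cdot> u \<preceq> y \<cdot> u"
proof -
  have "x \<cdot> u = (x \<cdot> x\<^sup>\<star>) \<cdot> (y \<cdot> u)"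
    using nat_le_ran[OF assms(1)] by (simp flip: mult_assoc)
  then show ?thesis using nat_le_Idp_mult[of "y \<cdot> u" "x \<cdot> x\<^sup>\<star>"] by simp
qed

lemma mult_inv_of_nat_le:
  assumes w: "w \<preceq> z" and [simp]: "w \<in> carrier S" "z \<in> carrier S"
  shows "w \<cdot> z\<^sup>\<star> = w \<cdot> w\<^sup>\<star>"
proof -
  define d where "d = w\<^sup>\<star> \<cdot> w"
  have [simp]: "d \<in> Idp S" by (simp add: d_def)
  have wd: "w \<cdot> d = w" by (simp add: d_def)
  have zd: "z \<cdot> d = w" using nat_le_dom[OF w] by (simp add: d_def)
  have "w \<cdot> z\<^sup>\<star> = w \<cdot> d \<cdot> z\<^sup>\<star>" by (simp only: wd)
  also have "\<dots> = w \<cdot> (z \<cdot> d)\<^sup>\<star>" by simp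
  finally show ?thesis by (simp only: zd)
qed

lemma inv_mult_of_nat_le:
  assumes w: "w \<preceq> z" and [simp]: "w \<in> carrier S" "z \<in> carrier S"
  shows "z\<^sup>\<star> \<cdot> w = w\<^sup>\<star> \<cdot> w"
proof -
  define r where "r = w \<cdot> w\<^sup>\<star>"
  have [simp]: "r \<in> Idp S" by (simp add: r_def)
  have rw: "r \<cdot> w = w" by (simp add: r_def)
  have rz: "r \<cdot> z = w" using nat_le_ran[OF w] by (simp add: r_def)
  have "z\<^sup>\<star> \<cdot> w = z\<^sup>\<star> \<cdot> (r \<cdot> w)" by (simp only: rw)
  also have "\<dots> = (r \<cdot> z)\<^sup>\<star> \<cdot> w" by simp
  finally show ?thesis by (simp only: rz)
qed

lemma Idp_nat_le_iff: "\<lbrakk>a \<in> Idp S; b \<in> Idp S\<rbrakk> \<Longrightarrow> a \<preceq> b \<longleftrightarrow> b \<cdot> a = a"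
  by (auto simp: nat_le_iff)

section \<open>Joins and dense families\<close>

definition is_join :: "'a set \<Rightarrow> 'a \<Rightarrow> bool" where
  "is_join X s \<longleftrightarrow> s \<in> carrier S \<and> (\<forall>x\<in>X. x \<preceq> s) \<and>
     (\<forall>t\<in>carrier S. (\<forall>x\<in>X. x \<preceq> t) \<longrightarrow> s \<preceq> t)"

lemma least_Upper_iff_is_join:
  "X \<subseteq> carrier S \<Longrightarrow> least (nat_order S) s (Upper (nat_order S) X) \<longleftrightarrow> is_join X s"
  unfolding least_def Upper_def is_join_def nat_order_def by (auto simp: subset_iff)

lemma is_join_unique: "\<lbrakk>is_join X s; is_join X t\<rbrakk> \<Longrightarrow> s = t"
  unfolding is_join_def by (meson nat_le_antisym)

lemma sup_eq:
  assumes "X \<subseteq> carrier S" "is_join X s"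
  shows "\<Squnion>\<^bsub>nat_order S\<^esub>X = s"
  unfolding Lattice.sup_def using assms
  by (simp add: least_Upper_iff_is_join) (metis is_join_unique someI)

lemma orth_join_eq:
  "\<lbrakk>x \<in> carrier S; y \<in> carrier S; is_join {x, y} s\<rbrakk> \<Longrightarrow> orth_join S x y = s"
  unfolding orth_join_def join_def by (rule sup_eq) auto

lemma orth_join_zero_right: "x \<in> carrier S \<Longrightarrow> orth_join S x \<^bold>0 = x"
  by (rule orth_join_eq) (auto simp: is_join_def)

text \<open>Joins in an inverse semigroup are not visibly preserved by multiplication. The condition below is:
the upper bound \<open>s\<close> is approximated by \<open>X\<close> so well that no idempotent annihilates \<open>X\<close> from the right
without annihilating \<open>s\<close>. In a Boolean inverse semigroup it describes the join of \<open>X\<close> whenever that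
join exists, for families of any size.\<close>

definition covers :: "'a set \<Rightarrow> 'a \<Rightarrow> bool" where
  "covers X s \<longleftrightarrow> s \<in> carrier S \<and> X \<subseteq> carrier S \<and> (\<forall>x\<in>X. x \<preceq> s) \<and>
     (\<forall>e\<in>Idp S. (\<forall>x\<in>X. x \<cdot> e = \<^bold>0) \<longrightarrow> s \<cdot> e = \<^bold>0)"

text \<open>If \<open>x u e = 0\<close> for all \<open>x\<close>, then the idempotent \<open>u e u\<^sup>-\<^sup>1\<close> annihilates every \<open>x\<close>, hence \<open>s\<close>;
multiply by \<open>u\<close> to get \<open>s u e = 0\<close>.\<close>

lemma covers_mult_right:
  assumes "covers X s" and [simp]: "u \<in> carrier S"
  shows "covers ((\<lambda>x. x \<cdot> u) ` X) (s \<cdot> u)"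
proof -
  have [simp]: "s \<in> carrier S" "\<And>x. x \<in> X \<Longrightarrow> x \<in> carrier S"
    and le: "\<And>x. x \<in> X \<Longrightarrow> x \<preceq> s"
    and dense: "\<And>e. e \<in> Idp S \<Longrightarrow> (\<And>x. x \<in> X \<Longrightarrow> x \<cdot> e = \<^bold>0) \<Longrightarrow> s \<cdot> e = \<^bold>0"
    using assms by (auto simp: covers_def)
  have "s \<cdot> u \<cdot> e = \<^bold>0" if [simp]: "e \<in> Idp S" and z: "\<And>x. x \<in> X \<Longrightarrow> x \<cdot> u \<cdot> e = \<^bold>0" for e
  proof -
    have "s \<cdot> (u \<cdot> (e \<cdot> u\<^sup>\<star>)) = \<^bold>0"
    proof (rule dense)
      fix x assume [simp]: "x \<in> X"
      have "x \<cdot> (u \<cdot> (e \<cdot> u\<^sup>\<star>)) = (x \<cdot> u \<cdot> e) \<cdot> u\<^sup>\<star>" by simp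
      then show "x \<cdot> (u \<cdot> (e \<cdot> u\<^sup>\<star>)) = \<^bold>0" by (simp only: z[OF \<open>x \<in> X\<close>]) simp
    qed simp
    then have "s \<cdot> (u \<cdot> (e \<cdot> u\<^sup>\<star>)) \<cdot> u = \<^bold>0" by (simp del: mult_assoc)
    then show ?thesis using Idp_push'[of u e] by simp
  qed
  then show ?thesis unfolding covers_def by (auto intro: nat_le_mult_right le)
qed

text \<open>If \<open>u x e = 0\<close> for all \<open>x\<close>, the witness is the domain \<open>k\<close> of \<open>w = u s e\<close>. Multiplying \<open>w\<close> on the right
by the domain of \<open>x\<close> gives \<open>u x e = 0\<close>, so \<open>k\<close> is disjoint from the domain of every \<open>x\<close>; therefore
\<open>s k = 0\<close>, and \<open>w = u s k e\<close> vanishes.\<close>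

lemma covers_mult_left:
  assumes "covers X s" and [simp]: "u \<in> carrier S"
  shows "covers ((\<lambda>x. u \<cdot> x) ` X) (u \<cdot> s)"
proof -
  have [simp]: "s \<in> carrier S" "\<And>x. x \<in> X \<Longrightarrow> x \<in> carrier S"
    and le: "\<And>x. x \<in> X \<Longrightarrow> x \<preceq> s"
    and dense: "\<And>e. e \<in> Idp S \<Longrightarrow> (\<And>x. x \<in> X \<Longrightarrow> x \<cdot> e = \<^bold>0) \<Longrightarrow> s \<cdot> e = \<^bold>0"
    using assms by (auto simp: covers_def)
  have "u \<cdot> s \<cdot> e = \<^bold>0" if [simp]: "e \<in> Idp S" and z: "\<And>x. x \<in> X \<Longrightarrow> u \<cdot> x \<cdot> e = \<^bold>0" for e
  proof -
    define w where "w = u \<cdot> s \<cdot> e"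
    define k where "k = w\<^sup>\<star> \<cdot> w"
    have [simp]: "w \<in> carrier S" by (simp add: w_def)
    then have [simp]: "k \<in> Idp S" by (simp add: k_def)
    have "s \<cdot> k = \<^bold>0"
    proof (rule dense)
      fix x assume [simp]: "x \<in> X"
      define d where "d = x\<^sup>\<star> \<cdot> x"
      have [simp]: "d \<in> Idp S" by (simp add: d_def)
      have x: "s \<cdot> d = x" using nat_le_dom[OF le] by (simp add: d_def)
      have "w \<cdot> d = u \<cdot> (s \<cdot> d) \<cdot> e" by (simp add: w_def Idp_commute[of e d])
      then have "w \<cdot> d = \<^bold>0" by (simp only: x z \<open>x \<in> X\<close>)
      then have "d \<cdot> k = \<^bold>0" by (simp add: k_def Idp_commute[of d "w\<^sup>\<star> \<cdot> w"])
      then have "x \<cdot> (d \<cdot> k) = \<^bold>0" by simp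
      then show "x \<cdot> k = \<^bold>0" by (simp add: d_def)
    qed simp
    moreover have "w = u \<cdot> (s \<cdot> k) \<cdot> e"
    proof -
      have "w = w \<cdot> k \<cdot> e" by (simp add: k_def) (simp add: w_def)
      also have "\<dots> = u \<cdot> (s \<cdot> (e \<cdot> k)) \<cdot> e" by (simp add: w_def)
      also have "\<dots> = u \<cdot> (s \<cdot> k) \<cdot> e" by (simp add: Idp_commute[of e k])
      finally show ?thesis .
    qed
    ultimately show ?thesis by (simp add: w_def[symmetric])
  qed
  then show ?thesis unfolding covers_def by (auto intro: nat_le_mult_left le)
qed

text \<open>Used to show that a product with a join is zero by checking it on the members of the family.\<close>

lemma covers_zero:
  assumes "covers X s" "X \<subseteq> {\<^bold>0}" shows "s = \<^bold>0"
proof -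
  have "s \<in> carrier S" "s \<cdot> (s\<^sup>\<star> \<cdot> s) = \<^bold>0" using assms unfolding covers_def
    by (auto dest!: bspec[of _ _ "s\<^sup>\<star> \<cdot> s"])
  then show ?thesis by simp
qed

text \<open>Density is transitive. This is what reduces the product of two joins, dense first in one factor and
then in the other, to the products of the members.\<close>

lemma covers_Union:
  assumes "covers (g ` I) s" "\<And>i. i \<in> I \<Longrightarrow> covers (Y i) (g i)"
  shows "covers (\<Union>i\<in>I. Y i) s"
proof -
  have s: "s \<in> carrier S" "\<And>i. i \<in> I \<Longrightarrow> g i \<in> carrier S" "\<And>i. i \<in> I \<Longrightarrow> g i \<preceq> s"
    using assms(1) by (auto simp: covers_def)
  have Y: "\<And>i y. i \<in> I \<Longrightarrow> y \<in> Y i \<Longrightarrow> y \<in> carrier S \<and> y \<preceq> g i"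
    using assms(2) by (auto simp: covers_def)
  have "y \<preceq> s" if "i \<in> I" "y \<in> Y i" for i y
    using nat_le_trans[of y "g i" s] Y[OF that] s that by blast
  moreover have "s \<cdot> e = \<^bold>0" if e: "e \<in> Idp S" "\<forall>y\<in>\<Union>i\<in>I. Y i. y \<cdot> e = \<^bold>0" for e
  proof -
    have "g i \<cdot> e = \<^bold>0" if "i \<in> I" for i
      using assms(2)[OF that] e that unfolding covers_def by blast
    then show ?thesis using assms(1) e(1) unfolding covers_def by blast
  qed
  ultimately show ?thesis using s Y unfolding covers_def by blast
qed

lemma covers_drop_zero:
  assumes "covers P s" "Q \<subseteq> P" "P \<subseteq> insert \<^bold>0 Q"
  shows "covers Q s"
proof -
  have "s \<cdot> e = \<^bold>0" if e: "e \<in> Idp S" "\<forall>x\<in>Q. x \<cdot> e = \<^bold>0" for e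
  proof -
    have "\<forall>x\<in>P. x \<cdot> e = \<^bold>0" using assms(3) e by auto
    then show ?thesis using assms(1) e(1) unfolding covers_def by blast
  qed
  then show ?thesis using assms(1,2) unfolding covers_def by blast
qed

lemma is_join_Un:
  assumes "is_join X s" "is_join Y t" "is_join (X \<union> Y) u" "X \<subseteq> carrier S" "Y \<subseteq> carrier S"
  shows "is_join {s, t} u"
proof -
  have c: "s \<in> carrier S" "t \<in> carrier S" "u \<in> carrier S" using assms by (auto simp: is_join_def)
  have "s \<preceq> u" "t \<preceq> u" using assms(1-3) by (auto simp: is_join_def)
  moreover have "u \<preceq> w" if w: "w \<in> carrier S" "s \<preceq> w" "t \<preceq> w" for w
  proof -
    have "x \<preceq> w" if "x \<in> X \<union> Y" for x
    proof -
      have "x \<in> carrier S" "x \<preceq> s \<or> x \<preceq> t" using that assms by (auto simp: is_join_def)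
      then show ?thesis using nat_le_trans c w by blast
    qed
    then show ?thesis using assms(3) w(1) by (auto simp: is_join_def)
  qed
  ultimately show ?thesis using c unfolding is_join_def by auto
qed

end

section \<open>Relative complements and orthogonal joins\<close>

context boolean_inverse_semigroup
begin

text \<open>Distributivity of the lattice of idempotents reads \<open>b e = a e \<or> c e\<close> for the complement \<open>c\<close> of \<open>a\<close>
in \<open>b\<close>, so \<open>b\<close> agrees with \<open>c\<close> on everything disjoint from \<open>a\<close>, and with \<open>a\<close> on everything disjoint
from \<open>c\<close>.\<close>

lemma Idp_complement:
  assumes a: "a \<in> Idp S" and b: "b \<in> Idp S" and le: "a \<preceq> b"
  obtains c where "c \<in> Idp S" "a \<cdot> c = \<^bold>0" "c \<preceq> b"
    "\<And>e. \<lbrakk>e \<in> Idp S; a \<cdot> e = \<^bold>0\<rbrakk> \<Longrightarrow> b \<cdot> e = c \<cdot> e"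
    "\<And>e. \<lbrakk>e \<in> Idp S; c \<cdot> e = \<^bold>0\<rbrakk> \<Longrightarrow> b \<cdot> e = a \<cdot> e"
proof -
  interpret L: generalized_boolean_algebra "Idp_order S" by (rule Idp_gba)
  let ?L = "Idp_order S"
  have car: "carrier ?L = Idp S" and le_L: "\<And>x y. x \<sqsubseteq>\<^bsub>?L\<^esub> y \<longleftrightarrow> x \<preceq> y"
    by (simp_all add: Idp_order_def)
  have meet: "x \<sqinter>\<^bsub>?L\<^esub> y = x \<cdot> y" if "x \<in> Idp S" "y \<in> Idp S" for x y
  proof (rule nat_le_antisym)
    have m: "x \<sqinter>\<^bsub>?L\<^esub> y \<in> Idp S" using L.meet_closed that car by auto
    have "x \<sqinter>\<^bsub>?L\<^esub> y \<preceq> x" "x \<sqinter>\<^bsub>?L\<^esub> y \<preceq> y" using L.meet_left L.meet_right that car le_L by auto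
    then show "x \<sqinter>\<^bsub>?L\<^esub> y \<preceq> x \<cdot> y" using that m by (simp add: Idp_nat_le_iff)
    show "x \<cdot> y \<preceq> x \<sqinter>\<^bsub>?L\<^esub> y"
      using L.meet_le[of "x \<cdot> y" x y] that car le_L by auto
    show "x \<sqinter>\<^bsub>?L\<^esub> y \<in> carrier S" using m by simp
  qed (use that in simp)
  have bot: "\<bottom>\<^bsub>?L\<^esub> = \<^bold>0"
  proof -
    have "\<bottom>\<^bsub>?L\<^esub> \<preceq> \<^bold>0" "\<bottom>\<^bsub>?L\<^esub> \<in> Idp S"
      using L.bottom_lower[of "\<^bold>0"] L.bottom_closed car le_L by auto
    then show ?thesis using nat_le_zero by simp
  qed
  have join0: "\<^bold>0 \<squnion>\<^bsub>?L\<^esub> x = x" "x \<squnion>\<^bsub>?L\<^esub> \<^bold>0 = x" if x: "x \<in> Idp S" for x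
  proof -
    have cl: "\<^bold>0 \<squnion>\<^bsub>?L\<^esub> x \<in> Idp S" using L.join_closed[of "\<^bold>0" x] car x by simp
    show "\<^bold>0 \<squnion>\<^bsub>?L\<^esub> x = x"
    proof (rule nat_le_antisym)
      show "\<^bold>0 \<squnion>\<^bsub>?L\<^esub> x \<preceq> x" using L.join_le[of "\<^bold>0" x x] x car le_L by simp
      show "x \<preceq> \<^bold>0 \<squnion>\<^bsub>?L\<^esub> x" using L.join_right[of "\<^bold>0" x] x car le_L by simp
    qed (use cl x in simp_all)
    then show "x \<squnion>\<^bsub>?L\<^esub> \<^bold>0 = x" by (simp add: join_comm)
  qed
  obtain c where c: "c \<in> Idp S" "a \<cdot> c = \<^bold>0" and j: "a \<squnion>\<^bsub>?L\<^esub> c = b"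
    using L.relative_complement[of a b] a b le car le_L meet bot by auto
  have up: "c \<preceq> b" using L.join_right[of a c] a c j car le_L by auto
  have dist: "b \<cdot> e = (a \<cdot> e) \<squnion>\<^bsub>?L\<^esub> (c \<cdot> e)" if "e \<in> Idp S" for e
    using L.meet_join_distrib[of e a c] a b c that car meet j by (simp add: Idp_commute)
  show ?thesis
    by (rule that[OF c up]) (simp_all add: dist join0 c a)
qed

text \<open>If an idempotent \<open>e\<close> kills all of \<open>X\<close>, then every \<open>x\<close> in \<open>X\<close> already lies below the restriction of
\<open>s\<close> to the complement of \<open>e\<close> in the domain of \<open>s\<close>; by minimality \<open>s\<close> equals that restriction.\<close>

lemma is_join_covers:
  assumes "is_join X s" "X \<subseteq> carrier S" shows "covers X s"
proof -
  have [simp]: "s \<in> carrier S" "\<And>x. x \<in> X \<Longrightarrow> x \<in> carrier S"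
    and le: "\<And>x. x \<in> X \<Longrightarrow> x \<preceq> s"
    and least: "\<And>t. t \<in> carrier S \<Longrightarrow> (\<And>x. x \<in> X \<Longrightarrow> x \<preceq> t) \<Longrightarrow> s \<preceq> t"
    using assms by (auto simp: is_join_def)
  have "s \<cdot> e = \<^bold>0" if [simp]: "e \<in> Idp S" and z: "\<And>x. x \<in> X \<Longrightarrow> x \<cdot> e = \<^bold>0" for e
  proof -
    define d where "d = s\<^sup>\<star> \<cdot> s"
    have d [simp]: "d \<in> Idp S" and sd: "s \<cdot> d = s" by (simp_all add: d_def)
    have "d \<cdot> e \<preceq> d" by simp
    then obtain c where c [simp]: "c \<in> Idp S" and dc: "d \<cdot> e \<cdot> c = \<^bold>0"
      and cov: "\<And>k. k \<in> Idp S \<Longrightarrow> d \<cdot> e \<cdot> k = \<^bold>0 \<Longrightarrow> d \<cdot> k = c \<cdot> k"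
      using Idp_complement[of "d \<cdot> e" d] d \<open>e \<in> Idp S\<close> Idp_mult by metis
    have "s \<preceq> s \<cdot> c"
    proof (rule least)
      fix x assume [simp]: "x \<in> X"
      define k where "k = x\<^sup>\<star> \<cdot> x"
      have [simp]: "k \<in> Idp S" by (simp add: k_def)
      have x: "x = s \<cdot> k" using nat_le_dom[OF le] by (simp add: k_def)
      have "e \<cdot> k = \<^bold>0" using z[of x] by (simp add: k_def Idp_commute[of e])
      then have "d \<cdot> k = c \<cdot> k" by (intro cov) simp_all
      then have "s \<cdot> (d \<cdot> k) = s \<cdot> c \<cdot> k" by simp
      moreover have "s \<cdot> (d \<cdot> k) = s \<cdot> k" using sd by (metis mult_assoc Idp_carrier d \<open>k \<in> Idp S\<close> \<open>s \<in> carrier S\<close>)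
      ultimately have "x = s \<cdot> c \<cdot> k" using x by simp
      then show "x \<preceq> s \<cdot> c" using nat_le_mult_Idp[of "s \<cdot> c" k] by simp
    qed simp
    then have s: "s = s \<cdot> c" by (intro nat_le_antisym) simp_all
    have "s \<cdot> e = s \<cdot> c \<cdot> e" by (rule arg_cong[OF s])
    also have "\<dots> = s \<cdot> (d \<cdot> e \<cdot> c)" by (simp add: d_def Idp_commute[of c e])
    finally show ?thesis using dc by simp
  qed
  then show ?thesis using assms le unfolding covers_def by auto
qed

text \<open>The join \<open>t\<close> is below \<open>s\<close>. The complement of the domain of \<open>t\<close> in that of \<open>s\<close> kills \<open>t\<close> and so every
member of \<open>X\<close>; since \<open>X\<close> is dense in \<open>s\<close>, it kills \<open>s\<close> as well, so it is zero.\<close>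

lemma covers_eq_join:
  assumes s: "covers X s" and t: "is_join X t"
  shows "s = t"
proof -
  have [simp]: "s \<in> carrier S" "t \<in> carrier S" "\<And>x. x \<in> X \<Longrightarrow> x \<in> carrier S" and "t \<preceq> s"
    and le: "\<And>x. x \<in> X \<Longrightarrow> x \<preceq> t"
    and dense: "\<And>e. e \<in> Idp S \<Longrightarrow> (\<And>x. x \<in> X \<Longrightarrow> x \<cdot> e = \<^bold>0) \<Longrightarrow> s \<cdot> e = \<^bold>0"
    using assms by (auto simp: covers_def is_join_def)
  define a b where "a = t\<^sup>\<star> \<cdot> t" and "b = s\<^sup>\<star> \<cdot> s"
  have [simp]: "a \<in> Idp S" "b \<in> Idp S" by (simp_all add: a_def b_def)
  have t: "t = s \<cdot> a" using nat_le_dom[OF \<open>t \<preceq> s\<close>] by (simp add: a_def)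
  have ta: "t \<cdot> a = t" and sb: "s \<cdot> b = s" by (simp_all add: a_def b_def)
  have "t \<cdot> b = t" unfolding t by (simp add: Idp_commute[of a b]) (simp add: b_def)
  then have "a \<preceq> b" by (simp add: Idp_nat_le_iff Idp_commute[of b a]) (simp add: a_def)
  then obtain c where c [simp]: "c \<in> Idp S" and ac: "a \<cdot> c = \<^bold>0" and "c \<preceq> b"
    and ba: "\<And>e. \<lbrakk>e \<in> Idp S; c \<cdot> e = \<^bold>0\<rbrakk> \<Longrightarrow> b \<cdot> e = a \<cdot> e"
    using Idp_complement[of a b] by (metis \<open>a \<in> Idp S\<close> \<open>b \<in> Idp S\<close>)
  have tc: "t \<cdot> c = \<^bold>0" using ta ac by (metis mult_assoc Idp_carrier \<open>a \<in> Idp S\<close> c \<open>t \<in> carrier S\<close> zero_right)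
  have "s \<cdot> c = \<^bold>0"
  proof (rule dense)
    fix x assume "x \<in> X"
    then show "x \<cdot> c = \<^bold>0"
      using nat_le_mult_right[OF le, of x c] tc nat_le_zero by simp
  qed simp
  then have "b \<cdot> c = \<^bold>0" by (simp add: b_def)
  then have "a \<cdot> b = b" using ba[of b] by (simp add: Idp_commute[of c b])
  moreover have "a \<cdot> b = a" using \<open>a \<preceq> b\<close> by (simp add: Idp_nat_le_iff Idp_commute[of b a])
  ultimately have "b = a" by simp
  then show ?thesis using t sb by simp
qed

text \<open>In the induction step, the new element is orthogonal to the join of the others because zero
products pass to joins.\<close>

lemma finite_orthogonal_join_exists:
  assumes "finite X" "X \<subseteq> carrier S"
    and "\<And>x y. \<lbrakk>x \<in> X; y \<in> X; x \<noteq> y\<rbrakk> \<Longrightarrow> orth S x y"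
  shows "\<exists>s. is_join X s"
  using assms
proof (induction X)
  case empty
  have "is_join {} \<^bold>0" by (simp add: is_join_def)
  then show ?case by blast
next
  case (insert x X)
  then obtain s where s: "is_join X s" by auto
  have [simp]: "x \<in> carrier S" "s \<in> carrier S" "\<And>y. y \<in> X \<Longrightarrow> y \<in> carrier S"
    and X: "X \<subseteq> carrier S"
    using insert.prems s by (auto simp: is_join_def)
  have o: "x\<^sup>\<star> \<cdot> y = \<^bold>0" "x \<cdot> y\<^sup>\<star> = \<^bold>0" if "y \<in> X" for y
    using insert.prems(2)[of x y] insert.hyps that by (auto simp: orth_def)
  have o': "y \<cdot> x\<^sup>\<star> = \<^bold>0" if "y \<in> X" for y
    using arg_cong[OF o(2)[OF that], of "sg_inv S"] that by simp
  have cov: "covers X s" using is_join_covers[OF s X] .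
  have "x\<^sup>\<star> \<cdot> s = \<^bold>0" using covers_zero[OF covers_mult_left[OF cov, of "x\<^sup>\<star>"]] o by auto
  moreover have "s \<cdot> x\<^sup>\<star> = \<^bold>0" using covers_zero[OF covers_mult_right[OF cov, of "x\<^sup>\<star>"]] o' by auto
  then have "(s \<cdot> x\<^sup>\<star>)\<^sup>\<star> = \<^bold>0" by (simp del: inv_mult)
  then have "x \<cdot> s\<^sup>\<star> = \<^bold>0" by simp
  ultimately have "orth S x s" by (simp add: orth_def)
  then obtain z where "is_join {x, s} z"
    using orth_join_exists[of x s] least_Upper_iff_is_join[of "{x, s}"] by auto
  then have "is_join (insert x X) z" using s
    unfolding is_join_def by (auto intro: nat_le_trans)
  then show ?case by blast
qed

lemma orth_is_join:
  assumes "x \<in> carrier S" "y \<in> carrier S" "orth S x y"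
  shows "is_join {x, y} (orth_join S x y)"
  using orth_join_exists[OF assms] orth_join_eq[of x y] assms(1,2)
  by (auto simp: least_Upper_iff_is_join)

lemma Idp_orth_iff: "\<lbrakk>a \<in> Idp S; b \<in> Idp S\<rbrakk> \<Longrightarrow> orth S a b \<longleftrightarrow> a \<cdot> b = \<^bold>0"
  by (auto simp: orth_def)

lemma Idp_orth_complement:
  assumes a: "a \<in> Idp S" and b: "b \<in> Idp S" and le: "a \<preceq> b"
  obtains c where "c \<in> Idp S" "a \<cdot> c = \<^bold>0" "c \<preceq> b" "orth_join S a c = b"
proof -
  from Idp_complement[OF assms] obtain c where c: "c \<in> Idp S" "a \<cdot> c = \<^bold>0" "c \<preceq> b"
    and ce: "\<And>e. \<lbrakk>e \<in> Idp S; a \<cdot> e = \<^bold>0\<rbrakk> \<Longrightarrow> b \<cdot> e = c \<cdot> e"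
    by metis
  have "covers {a, c} b" using a b c le ce by (auto simp: covers_def)
  moreover have "is_join {a, c} (orth_join S a c)"
    using a c by (intro orth_is_join) (auto simp: Idp_orth_iff)
  ultimately have "orth_join S a c = b" by (rule covers_eq_join[symmetric])
  with c that show ?thesis by blast
qed

end

section \<open>Groups with zero\<close>

context group
begin

lemma group_zero_carrier [simp]: "carrier (group_zero G) = insert None (Some ` carrier G)"
  by (simp add: group_zero_def)

lemma group_zero_zero [simp]: "sg_zero (group_zero G) = None"
  by (simp add: group_zero_def)

lemma group_zero_mult_eq_Some:
  "x \<cdot>\<^bsub>group_zero G\<^esub> y = Some c \<longleftrightarrow> (\<exists>a b. x = Some a \<and> y = Some b \<and> c = a \<otimes> b)"
  by (auto simp: group_zero_def split: option.split)

lemma group_zero_mult [simp]: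
  "None \<cdot>\<^bsub>group_zero G\<^esub> y = None" "x \<cdot>\<^bsub>group_zero G\<^esub> None = None"
  "Some a \<cdot>\<^bsub>group_zero G\<^esub> Some b = Some (a \<otimes> b)"
  by (auto simp: group_zero_def split: option.split)

lemma group_zero_is_inverse_iff:
  assumes "x \<in> carrier (group_zero G)"
  shows "is_inverse (group_zero G) x y \<longleftrightarrow> y = map_option (m_inv G) x"
proof (cases x)
  case None
  then show ?thesis by (cases y) (auto simp: is_inverse_def)
next
  case (Some a)
  then have a: "a \<in> carrier G" using assms by auto
  have "y = Some (inv a)" if "y = Some b" "b \<in> carrier G" "a = a \<otimes> b \<otimes> a" for b
  proof -
    have "a \<otimes> (b \<otimes> a) = a \<otimes> \<one>" using that a by (simp add: m_assoc)
    then have "b \<otimes> a = \<one>" using that a by (metis Units_eq Units_l_cancel m_closed one_closed)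
    then show ?thesis using that a by (metis inv_equality)
  qed
  then show ?thesis using a Some by (cases y) (auto simp: is_inverse_def m_assoc)
qed

lemma inverse_semigroup_group_zero: "inverse_semigroup_zero (group_zero G)"
  by unfold_locales (auto simp: group_zero_is_inverse_iff m_assoc)

lemma group_zero_inv:
  "x \<in> carrier (group_zero G) \<Longrightarrow> sg_inv (group_zero G) x = map_option (m_inv G) x"
  using inverse_semigroup_zero.inv_eqI[OF inverse_semigroup_group_zero]
  by (simp add: group_zero_is_inverse_iff)

lemma group_zero_nat_le_iff:
  assumes "x \<in> carrier (group_zero G)" "y \<in> carrier (group_zero G)"
  shows "nat_le (group_zero G) x y \<longleftrightarrow> x = None \<or> x = y"
  using assms by (auto simp: nat_le_def sg_dom_def group_zero_inv)

text \<open>The natural order of a group with zero is flat, so the families that have a join are those with at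
most one nonzero value, and that value is the join.\<close>

lemma group_zero_Join_eq_Some:
  assumes "\<And>i. i \<in> I \<Longrightarrow> x i \<in> carrier (group_zero G)"
    and one: "\<And>i j. \<lbrakk>i \<in> I; j \<in> I; x i \<noteq> None; x j \<noteq> None\<rbrakk> \<Longrightarrow> x i = x j"
  shows "orth_Join (group_zero G) I x = Some c \<longleftrightarrow> (\<exists>i\<in>I. x i = Some c)"
proof -
  interpret Z: inverse_semigroup_zero "group_zero G" by (rule inverse_semigroup_group_zero)
  have car: "x ` I \<subseteq> carrier (group_zero G)" using assms by blast
  define s where "s = (if \<exists>i\<in>I. x i \<noteq> None then x (SOME i. i \<in> I \<and> x i \<noteq> None) else None)"
  have s: "s = x i" if "i \<in> I" "x i \<noteq> None" for i
    using someI[of "\<lambda>i. i \<in> I \<and> x i \<noteq> None" i] that one by (auto simp: s_def)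
  have s0: "s = None \<or> (\<exists>i\<in>I. s = x i)"
    using s by (cases "\<exists>i\<in>I. x i \<noteq> None") (auto simp: s_def)
  then have sc: "s \<in> carrier (group_zero G)" using car by auto
  have "Z.is_join (x ` I) s"
    unfolding Z.is_join_def
  proof (intro conjI ballI impI)
    fix y assume "y \<in> x ` I"
    then obtain i where "i \<in> I" "y = x i" by blast
    moreover from this have "y \<in> carrier (group_zero G)" using car by blast
    ultimately show "nat_le (group_zero G) y s"
      unfolding group_zero_nat_le_iff[OF \<open>y \<in> carrier (group_zero G)\<close> sc] using s by metis
  next
    fix t assume t: "t \<in> carrier (group_zero G)" "\<forall>y\<in>x ` I. nat_le (group_zero G) y t"
    from s0 show "nat_le (group_zero G) s t"
      using t(2) group_zero_nat_le_iff[OF sc t(1)] by blast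
  qed (rule sc)
  then have "orth_Join (group_zero G) I x = s"
    unfolding orth_Join_def by (rule Z.sup_eq[OF car])
  then show ?thesis using s s0 by (metis option.distinct(1))
qed

end

section \<open>Rook matrices over a group with zero\<close>

lemma mat_option_eqI:
  assumes "A \<in> carrier_mat n n" "B \<in> carrier_mat n n"
    and "\<And>i j c. \<lbrakk>i < n; j < n\<rbrakk> \<Longrightarrow> A $$ (i, j) = Some c \<longleftrightarrow> B $$ (i, j) = Some c"
  shows "A = B"
proof (rule eq_matI)
  fix i j assume "i < dim_row B" "j < dim_col B"
  then have "A $$ (i, j) = Some c \<longleftrightarrow> B $$ (i, j) = Some c" for c
    using assms(2) by (intro assms(3)) auto
  then show "A $$ (i, j) = B $$ (i, j)" by (metis not_Some_eq)
qed (use assms(1,2) in auto)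

text \<open>The join of two matrices whose nonzero entries never meet in a row or a column.\<close>

definition rook_overlay :: "nat \<Rightarrow> 'a option mat \<Rightarrow> 'a option mat \<Rightarrow> 'a option mat" where
  "rook_overlay n A B = mat n n (\<lambda>p. if A $$ p = None then B $$ p else A $$ p)"

definition rook_unit :: "nat \<Rightarrow> nat \<Rightarrow> nat \<Rightarrow> 'a \<Rightarrow> 'a option mat" where
  "rook_unit n i j a = mat n n (\<lambda>p. if p = (i, j) then Some a else None)"

lemma rook_unit_eq_Some:
  "\<lbrakk>k < n; l < n\<rbrakk> \<Longrightarrow> rook_unit n i j a $$ (k, l) = Some b \<longleftrightarrow> k = i \<and> l = j \<and> b = a"
  by (auto simp: rook_unit_def)

context group
begin

text \<open>Over a group with zero a product vanishes only if a factor does. Hence the orthogonality conditions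
say that every row and every column has at most one nonzero entry.\<close>

lemma rook_matrices_group_zero_iff:
  "A \<in> rook_matrices n (group_zero G) \<longleftrightarrow> A \<in> carrier_mat n n \<and>
     (\<forall>i<n. \<forall>j<n. \<forall>a. A $$ (i, j) = Some a \<longrightarrow> a \<in> carrier G) \<and>
     (\<forall>i<n. \<forall>j<n. \<forall>k<n. A $$ (i, j) \<noteq> None \<longrightarrow> A $$ (i, k) \<noteq> None \<longrightarrow> j = k) \<and>
     (\<forall>i<n. \<forall>j<n. \<forall>k<n. A $$ (j, i) \<noteq> None \<longrightarrow> A $$ (k, i) \<noteq> None \<longrightarrow> j = k)"
proof -
  have car: "x \<in> carrier (group_zero G) \<longleftrightarrow> (\<forall>a. x = Some a \<longrightarrow> a \<in> carrier G)" for x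
    by (cases x) auto
  have z: "sg_inv (group_zero G) x \<cdot>\<^bsub>group_zero G\<^esub> y = None \<longleftrightarrow> x = None \<or> y = None"
     "y \<cdot>\<^bsub>group_zero G\<^esub> sg_inv (group_zero G) x = None \<longleftrightarrow> y = None \<or> x = None"
    if "x \<in> carrier (group_zero G)" for x y
    using that by (cases x; cases y; auto simp: group_zero_inv)+
  have zA: "sg_inv (group_zero G) (A $$ (i, j)) \<cdot>\<^bsub>group_zero G\<^esub> A $$ (i, k) = None \<longleftrightarrow>
      A $$ (i, j) = None \<or> A $$ (i, k) = None"
    "A $$ (j, i) \<cdot>\<^bsub>group_zero G\<^esub> sg_inv (group_zero G) (A $$ (k, i)) = None \<longleftrightarrow>
      A $$ (j, i) = None \<or> A $$ (k, i) = None"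
    if "\<forall>i<n. \<forall>j<n. A $$ (i, j) \<in> carrier (group_zero G)" "i < n" "j < n" "k < n" for i j k
    using that by (auto simp: z simp del: group_zero_carrier)
  show ?thesis
  proof (cases "\<forall>i<n. \<forall>j<n. A $$ (i, j) \<in> carrier (group_zero G)")
    case True
    then have entry: "\<forall>i<n. \<forall>j<n. \<forall>a. A $$ (i, j) = Some a \<longrightarrow> a \<in> carrier G"
      using car by metis
    have "(\<forall>i<n. \<forall>j<n. \<forall>k<n. j \<noteq> k \<longrightarrow>
        sg_inv (group_zero G) (A $$ (i, j)) \<cdot>\<^bsub>group_zero G\<^esub> A $$ (i, k) = None \<and>
        A $$ (j, i) \<cdot>\<^bsub>group_zero G\<^esub> sg_inv (group_zero G) (A $$ (k, i)) = None) \<longleftrightarrow>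
      (\<forall>i<n. \<forall>j<n. \<forall>k<n. (A $$ (i, j) \<noteq> None \<longrightarrow> A $$ (i, k) \<noteq> None \<longrightarrow> j = k) \<and>
        (A $$ (j, i) \<noteq> None \<longrightarrow> A $$ (k, i) \<noteq> None \<longrightarrow> j = k))"
      by (intro all_cong1 imp_cong refl) (auto simp: zA[OF True])
    also have "\<dots> \<longleftrightarrow>
      (\<forall>i<n. \<forall>j<n. \<forall>k<n. A $$ (i, j) \<noteq> None \<longrightarrow> A $$ (i, k) \<noteq> None \<longrightarrow> j = k) \<and>
      (\<forall>i<n. \<forall>j<n. \<forall>k<n. A $$ (j, i) \<noteq> None \<longrightarrow> A $$ (k, i) \<noteq> None \<longrightarrow> j = k)"
      by (simp only: all_conj_distrib imp_conjR)
    finally have rook: "(\<forall>i<n. \<forall>j<n. \<forall>k<n. j \<noteq> k \<longrightarrow>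
        sg_inv (group_zero G) (A $$ (i, j)) \<cdot>\<^bsub>group_zero G\<^esub> A $$ (i, k) = None \<and>
        A $$ (j, i) \<cdot>\<^bsub>group_zero G\<^esub> sg_inv (group_zero G) (A $$ (k, i)) = None) \<longleftrightarrow> \<dots>" .
    show ?thesis
      unfolding rook_matrices_def mem_Collect_eq group_zero_zero rook
      by (rule conj_cong[OF refl], rule conj_cong) (use True entry in blast, rule refl)
  next
    case False
    moreover have "\<not> (\<forall>i<n. \<forall>j<n. \<forall>a. A $$ (i, j) = Some a \<longrightarrow> a \<in> carrier G)"
      using False car by metis
    ultimately show ?thesis by (simp only: rook_matrices_def mem_Collect_eq simp_thms)
  qed
qed

lemma rook_mat_carrier: "carrier (rook_mat n (group_zero G)) = rook_matrices n (group_zero G)"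
  by (simp add: rook_mat_def)

lemma rook_carrier_mat:
  "A \<in> carrier (rook_mat n (group_zero G)) \<Longrightarrow> A \<in> carrier_mat n n"
  by (simp add: rook_mat_carrier rook_matrices_group_zero_iff)

lemma rook_entry_closed:
  "\<lbrakk>A \<in> carrier (rook_mat n (group_zero G)); A $$ (i, j) = Some a; i < n; j < n\<rbrakk> \<Longrightarrow> a \<in> carrier G"
  by (simp add: rook_mat_carrier rook_matrices_group_zero_iff)

lemma rook_row_unique:
  "\<lbrakk>A \<in> carrier (rook_mat n (group_zero G)); A $$ (i, j) = Some a; A $$ (i, k) = Some b;
    i < n; j < n; k < n\<rbrakk> \<Longrightarrow> j = k"
  unfolding rook_mat_carrier rook_matrices_group_zero_iff by blast

lemma rook_col_unique:
  "\<lbrakk>A \<in> carrier (rook_mat n (group_zero G)); A $$ (j, i) = Some a; A $$ (k, i) = Some b;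
    i < n; j < n; k < n\<rbrakk> \<Longrightarrow> j = k"
  unfolding rook_mat_carrier rook_matrices_group_zero_iff by blast

lemma rookI:
  assumes "A \<in> carrier_mat n n"
    "\<And>i j a. \<lbrakk>i < n; j < n; A $$ (i, j) = Some a\<rbrakk> \<Longrightarrow> a \<in> carrier G"
    "\<And>i j k a b. \<lbrakk>i < n; j < n; k < n; A $$ (i, j) = Some a; A $$ (i, k) = Some b\<rbrakk> \<Longrightarrow> j = k"
    "\<And>i j k a b. \<lbrakk>i < n; j < n; k < n; A $$ (j, i) = Some a; A $$ (k, i) = Some b\<rbrakk> \<Longrightarrow> j = k"
  shows "A \<in> carrier (rook_mat n (group_zero G))"
  unfolding rook_mat_carrier rook_matrices_group_zero_iff using assms by blast

lemma rook_zero: "sg_zero (rook_mat n (group_zero G)) = mat n n (\<lambda>_. None)"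
  by (simp add: rook_mat_def)

lemma rook_mult_carrier_mat [simp]: "A \<cdot>\<^bsub>rook_mat n (group_zero G)\<^esub> B \<in> carrier_mat n n"
  by (simp add: rook_mat_def)

text \<open>Since a row of \<open>A\<close> has only one nonzero entry, the join in the definition of the product is taken
over at most one nonzero term: matrices multiply like partial bijections labelled by group elements.\<close>

lemma rook_mult_eq_Some:
  assumes A: "A \<in> carrier (rook_mat n (group_zero G))" and B: "B \<in> carrier (rook_mat n (group_zero G))"
    and ij: "i < n" "j < n"
  shows "(A \<cdot>\<^bsub>rook_mat n (group_zero G)\<^esub> B) $$ (i, j) = Some c \<longleftrightarrow>
    (\<exists>k a b. k < n \<and> A $$ (i, k) = Some a \<and> B $$ (k, j) = Some b \<and> c = a \<otimes> b)"
proof -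
  let ?x = "\<lambda>k. A $$ (i, k) \<cdot>\<^bsub>group_zero G\<^esub> B $$ (k, j)"
  have "?x k \<in> carrier (group_zero G)" if "k < n" for k
    using rook_entry_closed[OF A, of i k] rook_entry_closed[OF B, of k j] ij that
    by (cases "A $$ (i, k)"; cases "B $$ (k, j)") auto
  moreover have "?x k = ?x l" if "k < n" "l < n" "?x k \<noteq> None" "?x l \<noteq> None" for k l
    using that rook_row_unique[OF A, of i k _ l] ij by (auto simp: group_zero_mult_eq_Some)
  ultimately have "orth_Join (group_zero G) {..<n} ?x = Some c \<longleftrightarrow> (\<exists>k\<in>{..<n}. ?x k = Some c)"
    by (intro group_zero_Join_eq_Some) auto
  then show ?thesis using ij by (auto simp: rook_mat_def group_zero_mult_eq_Some)
qed

lemma rook_mult_closed: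
  assumes A: "A \<in> carrier (rook_mat n (group_zero G))" and B: "B \<in> carrier (rook_mat n (group_zero G))"
  shows "A \<cdot>\<^bsub>rook_mat n (group_zero G)\<^esub> B \<in> carrier (rook_mat n (group_zero G))"
proof (rule rookI)
  fix i j a
  assume "i < n" "j < n" "(A \<cdot>\<^bsub>rook_mat n (group_zero G)\<^esub> B) $$ (i, j) = Some a"
  then show "a \<in> carrier G"
    by (auto simp: rook_mult_eq_Some[OF A B] dest: rook_entry_closed[OF A] rook_entry_closed[OF B])
next
  fix i j k a b
  assume "i < n" "j < n" "k < n" "(A \<cdot>\<^bsub>rook_mat n (group_zero G)\<^esub> B) $$ (i, j) = Some a"
    "(A \<cdot>\<^bsub>rook_mat n (group_zero G)\<^esub> B) $$ (i, k) = Some b"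
  then show "j = k"
    using rook_row_unique[OF A] rook_row_unique[OF B] unfolding rook_mult_eq_Some[OF A B]
    by (simp add: rook_mult_eq_Some[OF A B]) metis
next
  fix i j k a b
  assume "i < n" "j < n" "k < n" "(A \<cdot>\<^bsub>rook_mat n (group_zero G)\<^esub> B) $$ (j, i) = Some a"
    "(A \<cdot>\<^bsub>rook_mat n (group_zero G)\<^esub> B) $$ (k, i) = Some b"
  then show "j = k"
    using rook_col_unique[OF A] rook_col_unique[OF B]
    by (simp add: rook_mult_eq_Some[OF A B]) metis
qed simp

lemma rook_mult_assoc:
  assumes A: "A \<in> carrier (rook_mat n (group_zero G))" and B: "B \<in> carrier (rook_mat n (group_zero G))"
    and C: "C \<in> carrier (rook_mat n (group_zero G))"
  shows "(A \<cdot>\<^bsub>rook_mat n (group_zero G)\<^esub> B) \<cdot>\<^bsub>rook_mat n (group_zero G)\<^esub> C =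
    A \<cdot>\<^bsub>rook_mat n (group_zero G)\<^esub> (B \<cdot>\<^bsub>rook_mat n (group_zero G)\<^esub> C)"
    (is "(A \<cdot>\<^bsub>?R\<^esub> B) \<cdot>\<^bsub>?R\<^esub> C = _")
proof (rule mat_option_eqI)
  fix i j c assume ij: "i < n" "j < n"
  have AB: "A \<cdot>\<^bsub>?R\<^esub> B \<in> carrier ?R" and BC: "B \<cdot>\<^bsub>?R\<^esub> C \<in> carrier ?R"
    using A B C by (auto intro: rook_mult_closed)
  have as: "(a \<otimes> b) \<otimes> d = a \<otimes> (b \<otimes> d)" if "k < n" "l < n"
     "A $$ (i, k) = Some a" "B $$ (k, l) = Some b" "C $$ (l, j) = Some d" for a b d k l
    using that ij by (metis m_assoc rook_entry_closed A B C)
  have "((A \<cdot>\<^bsub>?R\<^esub> B) \<cdot>\<^bsub>?R\<^esub> C) $$ (i, j) = Some c \<longleftrightarrow>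
    (\<exists>l k a b d. k < n \<and> l < n \<and> A $$ (i, k) = Some a \<and> B $$ (k, l) = Some b \<and>
      C $$ (l, j) = Some d \<and> c = (a \<otimes> b) \<otimes> d)" (is "_ = ?P")
    using ij by (simp add: rook_mult_eq_Some[OF AB C] rook_mult_eq_Some[OF A B] cong: conj_cong) metis
  moreover have "(A \<cdot>\<^bsub>?R\<^esub> (B \<cdot>\<^bsub>?R\<^esub> C)) $$ (i, j) = Some c \<longleftrightarrow>
    (\<exists>l k a b d. k < n \<and> l < n \<and> A $$ (i, k) = Some a \<and> B $$ (k, l) = Some b \<and>
      C $$ (l, j) = Some d \<and> c = a \<otimes> (b \<otimes> d))" (is "_ = ?Q")
    using ij by (simp add: rook_mult_eq_Some[OF A BC] rook_mult_eq_Some[OF B C] cong: conj_cong) metis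
  moreover have "?P \<longleftrightarrow> ?Q" using as by metis
  ultimately show "((A \<cdot>\<^bsub>?R\<^esub> B) \<cdot>\<^bsub>?R\<^esub> C) $$ (i, j) = Some c \<longleftrightarrow>
    (A \<cdot>\<^bsub>?R\<^esub> (B \<cdot>\<^bsub>?R\<^esub> C)) $$ (i, j) = Some c" by simp
qed simp_all

text \<open>From \<open>E E = E\<close> the entry at \<open>(i, j)\<close> factors through some \<open>k\<close> with nonzero entries at \<open>(i, k)\<close> and
\<open>(k, j)\<close>; uniqueness in row \<open>i\<close> and in column \<open>j\<close> forces \<open>i = k = j\<close>. Idempotents are thus partial
identities, and commute.\<close>

lemma rook_Idp_diagonal:
  assumes E: "E \<in> Idp (rook_mat n (group_zero G))" and ij: "i < n" "j < n" "E $$ (i, j) = Some a"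
  shows "i = j \<and> a = \<one>"
proof -
  have Ec: "E \<in> carrier (rook_mat n (group_zero G))" and EE: "E \<cdot>\<^bsub>rook_mat n (group_zero G)\<^esub> E = E"
    using E by (auto simp: Idp_def)
  then obtain k b c where k: "k < n" "E $$ (i, k) = Some b" "E $$ (k, j) = Some c" "a = b \<otimes> c"
    using rook_mult_eq_Some[OF Ec Ec, of i j a] ij by auto
  have "k = j" using rook_row_unique[OF Ec] k ij by metis
  moreover have "k = i" using rook_col_unique[OF Ec] k ij by metis
  ultimately show ?thesis using k ij rook_entry_closed[OF Ec, of i j] by auto
qed

lemma rook_Idp_mult_eq_Some:
  assumes E: "E \<in> Idp (rook_mat n (group_zero G))" "F \<in> Idp (rook_mat n (group_zero G))"
    and ij: "i < n" "j < n"
  shows "(E \<cdot>\<^bsub>rook_mat n (group_zero G)\<^esub> F) $$ (i, j) = Some c \<longleftrightarrow>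
     E $$ (i, j) = Some c \<and> F $$ (i, j) = Some c"
proof -
  have "E \<in> carrier (rook_mat n (group_zero G))" "F \<in> carrier (rook_mat n (group_zero G))"
    using E by (auto simp: Idp_def)
  then show ?thesis
    using rook_Idp_diagonal[OF E(1)] rook_Idp_diagonal[OF E(2)] ij
    by (simp add: rook_mult_eq_Some) (metis r_one one_closed)
qed

lemma rook_Idp_commute:
  assumes "E \<in> Idp (rook_mat n (group_zero G))" "F \<in> Idp (rook_mat n (group_zero G))"
  shows "E \<cdot>\<^bsub>rook_mat n (group_zero G)\<^esub> F = F \<cdot>\<^bsub>rook_mat n (group_zero G)\<^esub> E"
  by (rule mat_option_eqI[where n = n]) (auto simp: rook_Idp_mult_eq_Some assms)

definition rook_inv :: "nat \<Rightarrow> 'a option mat \<Rightarrow> 'a option mat" where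
  "rook_inv n A = mat n n (\<lambda>(i, j). map_option (m_inv G) (A $$ (j, i)))"

lemma rook_inv_eq_Some:
  "\<lbrakk>i < n; j < n\<rbrakk> \<Longrightarrow> rook_inv n A $$ (i, j) = Some c \<longleftrightarrow> (\<exists>a. A $$ (j, i) = Some a \<and> c = inv a)"
  by (auto simp: rook_inv_def)

lemma rook_inv_closed:
  assumes A: "A \<in> carrier (rook_mat n (group_zero G))"
  shows "rook_inv n A \<in> carrier (rook_mat n (group_zero G))"
  by (rule rookI)
    (auto simp: rook_inv_eq_Some intro: rook_entry_closed[OF A] rook_row_unique[OF A] rook_col_unique[OF A],
     simp add: rook_inv_def)

lemma rook_is_inverse:
  assumes A: "A \<in> carrier (rook_mat n (group_zero G))"
  shows "is_inverse (rook_mat n (group_zero G)) A (rook_inv n A)"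
proof -
  let ?R = "rook_mat n (group_zero G)"
  note B = rook_inv_closed[OF A]
  note AB = rook_mult_closed[OF A B] and BA = rook_mult_closed[OF B A]
  have "A = A \<cdot>\<^bsub>?R\<^esub> rook_inv n A \<cdot>\<^bsub>?R\<^esub> A"
  proof (rule mat_option_eqI)
    fix i j c assume ij: "i < n" "j < n"
    have entry: "(A \<cdot>\<^bsub>?R\<^esub> rook_inv n A \<cdot>\<^bsub>?R\<^esub> A) $$ (i, j) = Some c \<longleftrightarrow>
      (\<exists>k a b. k < n \<and> (\<exists>l d e. l < n \<and> A $$ (i, l) = Some d \<and>
        (\<exists>f. A $$ (k, l) = Some f \<and> e = inv f) \<and> a = d \<otimes> e) \<and> A $$ (k, j) = Some b \<and> c = a \<otimes> b)"
      using ij by (simp add: rook_mult_eq_Some[OF AB A] rook_mult_eq_Some[OF A B] rook_inv_eq_Some cong: conj_cong)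
    show "A $$ (i, j) = Some c \<longleftrightarrow> (A \<cdot>\<^bsub>?R\<^esub> rook_inv n A \<cdot>\<^bsub>?R\<^esub> A) $$ (i, j) = Some c"
    proof
      assume c: "A $$ (i, j) = Some c"
      then show "(A \<cdot>\<^bsub>?R\<^esub> rook_inv n A \<cdot>\<^bsub>?R\<^esub> A) $$ (i, j) = Some c"
        unfolding entry using rook_entry_closed[OF A c ij] ij
        by (intro exI[of _ i] exI[of _ "c \<otimes> inv c"] exI[of _ c] conjI exI[of _ j] exI[of _ "inv c"]) auto
    next
      assume "(A \<cdot>\<^bsub>?R\<^esub> rook_inv n A \<cdot>\<^bsub>?R\<^esub> A) $$ (i, j) = Some c"
      then obtain k l b d f where *: "k < n" "l < n" "A $$ (i, l) = Some d" "A $$ (k, l) = Some f"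
        "A $$ (k, j) = Some b" and c: "c = d \<otimes> inv f \<otimes> b" unfolding entry by blast
      have "k = i" using rook_col_unique[OF A *(4,3)] * ij by blast
      moreover from this have "l = j" using rook_row_unique[OF A *(3)] * ij by blast
      ultimately show "A $$ (i, j) = Some c" using * c rook_entry_closed[OF A *(3)] ij by auto
    qed
  qed (use A in \<open>auto intro: rook_carrier_mat\<close>)
  moreover have "rook_inv n A = rook_inv n A \<cdot>\<^bsub>?R\<^esub> A \<cdot>\<^bsub>?R\<^esub> rook_inv n A"
  proof (rule mat_option_eqI)
    fix i j c assume ij: "i < n" "j < n"
    have entry: "(rook_inv n A \<cdot>\<^bsub>?R\<^esub> A \<cdot>\<^bsub>?R\<^esub> rook_inv n A) $$ (i, j) = Some c \<longleftrightarrow>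
      (\<exists>k a b. k < n \<and> (\<exists>l d e. l < n \<and> (\<exists>f. A $$ (l, i) = Some f \<and> d = inv f) \<and>
        A $$ (l, k) = Some e \<and> a = d \<otimes> e) \<and> (\<exists>g. A $$ (j, k) = Some g \<and> b = inv g) \<and> c = a \<otimes> b)"
      using ij by (simp add: rook_mult_eq_Some[OF BA B] rook_mult_eq_Some[OF B A] rook_inv_eq_Some cong: conj_cong)
    show "rook_inv n A $$ (i, j) = Some c \<longleftrightarrow> (rook_inv n A \<cdot>\<^bsub>?R\<^esub> A \<cdot>\<^bsub>?R\<^esub> rook_inv n A) $$ (i, j) = Some c"
    proof
      assume "rook_inv n A $$ (i, j) = Some c"
      then obtain g where g: "A $$ (j, i) = Some g" "c = inv g" using ij by (auto simp: rook_inv_eq_Some)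
      then show "(rook_inv n A \<cdot>\<^bsub>?R\<^esub> A \<cdot>\<^bsub>?R\<^esub> rook_inv n A) $$ (i, j) = Some c"
        unfolding entry using rook_entry_closed[OF A g(1)] ij
        by (intro exI[of _ i] exI[of _ "inv g \<otimes> g"] exI[of _ g] conjI exI[of _ j] exI[of _ "inv g"]) auto
    next
      assume "(rook_inv n A \<cdot>\<^bsub>?R\<^esub> A \<cdot>\<^bsub>?R\<^esub> rook_inv n A) $$ (i, j) = Some c"
      then obtain k l e f g where *: "k < n" "l < n" "A $$ (l, i) = Some f" "A $$ (l, k) = Some e"
        "A $$ (j, k) = Some g" and c: "c = inv f \<otimes> e \<otimes> inv g" unfolding entry by blast
      have "k = i" using rook_row_unique[OF A *(4,3)] * ij by blast
      moreover from this have "l = j" using rook_col_unique[OF A *(3)] * ij by blast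
      ultimately show "rook_inv n A $$ (i, j) = Some c"
        using * c rook_entry_closed[OF A *(3)] ij by (auto simp: rook_inv_eq_Some)
    qed
  qed (use B in \<open>auto intro: rook_carrier_mat\<close>)
  ultimately show ?thesis using B by (simp add: is_inverse_def)
qed

lemma inverse_semigroup_rook_mat: "inverse_semigroup_zero (rook_mat n (group_zero G))"
proof -
  let ?R = "rook_mat n (group_zero G)"
  have unique: "\<exists>!B. is_inverse ?R A B" if A: "A \<in> carrier ?R" for A
  proof (rule ex1I[where a = "rook_inv n A"])
    show "is_inverse ?R A (rook_inv n A)" by (rule rook_is_inverse[OF A])
  next
    fix B assume "is_inverse ?R A B"
    then show "B = rook_inv n A"
      by (intro inverse_unique_if_Idp_commute[where S = ?R and x = A and y = B])
        (rule rook_mult_closed rook_mult_assoc rook_Idp_commute rook_is_inverse A | assumption)+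
  qed
  have Z: "sg_zero ?R \<in> carrier ?R" by (rule rookI) (auto simp: rook_zero)
  have z: "sg_zero ?R $$ (i, j) = None" if "i < n" "j < n" for i j
    using that by (simp add: rook_zero)
  have left: "sg_zero ?R \<cdot>\<^bsub>?R\<^esub> A = sg_zero ?R" if A: "A \<in> carrier ?R" for A
    by (rule mat_option_eqI[where n = n])
      (simp_all add: rook_mult_eq_Some[OF Z A] z rook_carrier_mat[OF Z] cong: conj_cong)
  have right: "A \<cdot>\<^bsub>?R\<^esub> sg_zero ?R = sg_zero ?R" if A: "A \<in> carrier ?R" for A
    by (rule mat_option_eqI[where n = n])
      (simp_all add: rook_mult_eq_Some[OF A Z] z rook_carrier_mat[OF Z] cong: conj_cong)
  show ?thesis
    by (rule inverse_semigroup_zero.intro)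
      (rule rook_mult_closed rook_mult_assoc unique Z left right; assumption)+
qed

lemma rook_inv_eq:
  "A \<in> carrier (rook_mat n (group_zero G)) \<Longrightarrow> sg_inv (rook_mat n (group_zero G)) A = rook_inv n A"
  using inverse_semigroup_zero.inv_eqI[OF inverse_semigroup_rook_mat] rook_is_inverse by blast

text \<open>The natural order is inclusion of the sets of nonzero entries, because multiplying by the domain of
\<open>A\<close> erases exactly the columns in which \<open>A\<close> is zero.\<close>

lemma rook_nat_le_iff:
  assumes A: "A \<in> carrier (rook_mat n (group_zero G))" and B: "B \<in> carrier (rook_mat n (group_zero G))"
  shows "nat_le (rook_mat n (group_zero G)) A B \<longleftrightarrow>
    (\<forall>i<n. \<forall>j<n. \<forall>a. A $$ (i, j) = Some a \<longrightarrow> B $$ (i, j) = Some a)"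
proof -
  let ?R = "rook_mat n (group_zero G)"
  note A' = rook_inv_closed[OF A]
  note D = rook_mult_closed[OF A' A]
  have dom: "(rook_inv n A \<cdot>\<^bsub>?R\<^esub> A) $$ (k, j) = Some c \<longleftrightarrow>
      k = j \<and> c = \<one> \<and> (\<exists>i<n. A $$ (i, j) \<noteq> None)" if "k < n" "j < n" for k j c
  proof -
    have "inv a \<otimes> b = \<one> \<and> k = j" if "l < n" "A $$ (l, k) = Some a" "A $$ (l, j) = Some b" for a b l
    proof -
      have "k = j" using rook_row_unique[OF A] that \<open>k < n\<close> \<open>j < n\<close> by metis
      then show ?thesis using that rook_entry_closed[OF A, of l k] \<open>k < n\<close> by auto
    qed
    then show ?thesis using that
      by (auto simp: rook_mult_eq_Some[OF A' A] rook_inv_eq_Some)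
  qed
  have BD: "(B \<cdot>\<^bsub>?R\<^esub> (rook_inv n A \<cdot>\<^bsub>?R\<^esub> A)) $$ (i, j) = Some c \<longleftrightarrow>
      B $$ (i, j) = Some c \<and> (\<exists>k<n. A $$ (k, j) \<noteq> None)" if "i < n" "j < n" for i j c
    using that rook_entry_closed[OF B, of i j]
    by (auto simp: rook_mult_eq_Some[OF B D] dom cong: conj_cong, intro exI[of _ j], auto)
  have "A = B \<cdot>\<^bsub>?R\<^esub> (rook_inv n A \<cdot>\<^bsub>?R\<^esub> A) \<longleftrightarrow>
     (\<forall>i<n. \<forall>j<n. \<forall>c. A $$ (i, j) = Some c \<longleftrightarrow> B $$ (i, j) = Some c \<and> (\<exists>k<n. A $$ (k, j) \<noteq> None))"
  proof
    assume *: "A = B \<cdot>\<^bsub>?R\<^esub> (rook_inv n A \<cdot>\<^bsub>?R\<^esub> A)"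
    show "\<forall>i<n. \<forall>j<n. \<forall>c. A $$ (i, j) = Some c \<longleftrightarrow> B $$ (i, j) = Some c \<and> (\<exists>k<n. A $$ (k, j) \<noteq> None)"
      using BD arg_cong[OF *, of "\<lambda>M. M $$ (_, _)"] by metis
  next
    assume *: "\<forall>i<n. \<forall>j<n. \<forall>c. A $$ (i, j) = Some c \<longleftrightarrow> B $$ (i, j) = Some c \<and> (\<exists>k<n. A $$ (k, j) \<noteq> None)"
    show "A = B \<cdot>\<^bsub>?R\<^esub> (rook_inv n A \<cdot>\<^bsub>?R\<^esub> A)"
      by (rule mat_option_eqI[where n = n]) (use BD * in \<open>simp_all add: rook_carrier_mat[OF A]\<close>)
  qed
  also have "\<dots> \<longleftrightarrow> (\<forall>i<n. \<forall>j<n. \<forall>a. A $$ (i, j) = Some a \<longrightarrow> B $$ (i, j) = Some a)"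
  proof
    assume *: "\<forall>i<n. \<forall>j<n. \<forall>a. A $$ (i, j) = Some a \<longrightarrow> B $$ (i, j) = Some a"
    have "A $$ (i, j) = Some c \<longleftrightarrow> B $$ (i, j) = Some c \<and> (\<exists>k<n. A $$ (k, j) \<noteq> None)"
      if ij: "i < n" "j < n" for i j c
    proof
      assume "B $$ (i, j) = Some c \<and> (\<exists>k<n. A $$ (k, j) \<noteq> None)"
      then obtain k a where k: "k < n" "A $$ (k, j) = Some a" "B $$ (i, j) = Some c" by auto
      then have "B $$ (k, j) = Some a" using * ij by blast
      moreover from this have "k = i" using rook_col_unique[OF B _ k(3)] k ij by blast
      ultimately show "A $$ (i, j) = Some c" using k by simp
    qed (use * ij in auto)
    then show "\<forall>i<n. \<forall>j<n. \<forall>c. A $$ (i, j) = Some c \<longleftrightarrow>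
      B $$ (i, j) = Some c \<and> (\<exists>k<n. A $$ (k, j) \<noteq> None)" by blast
  qed blast
  finally show ?thesis using A by (simp add: nat_le_def sg_dom_def rook_inv_eq)
qed

lemma rook_orth_disjoint_support:
  assumes A: "A \<in> carrier (rook_mat n (group_zero G))" and B: "B \<in> carrier (rook_mat n (group_zero G))"
    and orth: "orth (rook_mat n (group_zero G)) A B"
    and "i < n" "j < n" "k < n" "l < n" "A $$ (i, j) = Some a" "B $$ (k, l) = Some b"
  shows "i \<noteq> k" "j \<noteq> l"
proof -
  let ?R = "rook_mat n (group_zero G)"
  have o: "rook_inv n A \<cdot>\<^bsub>?R\<^esub> B = sg_zero ?R" "A \<cdot>\<^bsub>?R\<^esub> rook_inv n B = sg_zero ?R"
    using orth A B by (auto simp: orth_def rook_inv_eq)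
  show "i \<noteq> k"
  proof
    assume "i = k"
    then have "(rook_inv n A \<cdot>\<^bsub>?R\<^esub> B) $$ (j, l) = Some (inv a \<otimes> b)"
      using assms by (auto simp: rook_mult_eq_Some[OF rook_inv_closed[OF A] B] rook_inv_eq_Some)
    then show False using o assms by (simp add: rook_zero)
  qed
  show "j \<noteq> l"
  proof
    assume "j = l"
    then have "(A \<cdot>\<^bsub>?R\<^esub> rook_inv n B) $$ (i, k) = Some (a \<otimes> inv b)"
      using assms by (auto simp: rook_mult_eq_Some[OF A rook_inv_closed[OF B]] rook_inv_eq_Some)
    then show False using o assms by (simp add: rook_zero)
  qed
qed

lemma rook_orth_join:
  assumes A: "A \<in> carrier (rook_mat n (group_zero G))" and B: "B \<in> carrier (rook_mat n (group_zero G))"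
    and orth: "orth (rook_mat n (group_zero G)) A B"
  shows "orth_join (rook_mat n (group_zero G)) A B = rook_overlay n A B"
    and "rook_overlay n A B \<in> carrier (rook_mat n (group_zero G))"
    and "\<And>i j c. \<lbrakk>i < n; j < n\<rbrakk> \<Longrightarrow> rook_overlay n A B $$ (i, j) = Some c \<longleftrightarrow>
      A $$ (i, j) = Some c \<or> B $$ (i, j) = Some c"
proof -
  let ?R = "rook_mat n (group_zero G)"
  interpret R: inverse_semigroup_zero ?R by (rule inverse_semigroup_rook_mat)
  note dis = rook_orth_disjoint_support[OF A B orth]
  show e: "rook_overlay n A B $$ (i, j) = Some c \<longleftrightarrow>
      A $$ (i, j) = Some c \<or> B $$ (i, j) = Some c" if "i < n" "j < n" for i j c
    using that dis[of i j i j] by (auto simp: rook_overlay_def)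
  show C: "rook_overlay n A B \<in> carrier ?R"
  proof (rule rookI)
    show "rook_overlay n A B \<in> carrier_mat n n" by (simp add: rook_overlay_def)
  next
    fix i j a assume "i < n" "j < n" "rook_overlay n A B $$ (i, j) = Some a"
    then show "a \<in> carrier G" using rook_entry_closed[OF A] rook_entry_closed[OF B] by (auto simp: e)
  next
    fix i j k a b
    assume "i < n" "j < n" "k < n" "rook_overlay n A B $$ (i, j) = Some a" "rook_overlay n A B $$ (i, k) = Some b"
    then show "j = k" using rook_row_unique[OF A] rook_row_unique[OF B] dis(1) by (simp add: e) metis
  next
    fix i j k a b
    assume "i < n" "j < n" "k < n" "rook_overlay n A B $$ (j, i) = Some a" "rook_overlay n A B $$ (k, i) = Some b"
    then show "j = k" using rook_col_unique[OF A] rook_col_unique[OF B] dis(2) by (simp add: e) metis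
  qed
  have "R.is_join {A, B} (rook_overlay n A B)"
    using A B C by (auto simp: R.is_join_def rook_nat_le_iff e)
  then show "orth_join ?R A B = rook_overlay n A B" using A B by (intro R.orth_join_eq)
qed

lemma rook_unit_closed [simp]:
  "a \<in> carrier G \<Longrightarrow> rook_unit n i j a \<in> carrier (rook_mat n (group_zero G))"
  by (rule rookI) (auto simp: rook_unit_eq_Some, simp add: rook_unit_def)

lemma rook_unit_mult:
  assumes "i < n" "j < n" "k < n" "l < n" "a \<in> carrier G" "b \<in> carrier G"
  shows "rook_unit n i k a \<cdot>\<^bsub>rook_mat n (group_zero G)\<^esub> rook_unit n l j b =
    (if k = l then rook_unit n i j (a \<otimes> b) else sg_zero (rook_mat n (group_zero G)))"
proof (rule mat_option_eqI[where n = n])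
  fix r s c assume "r < n" "s < n"
  then show "(rook_unit n i k a \<cdot>\<^bsub>rook_mat n (group_zero G)\<^esub> rook_unit n l j b) $$ (r, s) = Some c \<longleftrightarrow>
    (if k = l then rook_unit n i j (a \<otimes> b) else sg_zero (rook_mat n (group_zero G))) $$ (r, s) = Some c"
    using assms by (auto simp: rook_mult_eq_Some rook_unit_eq_Some rook_zero cong: conj_cong)
qed (auto simp: rook_unit_def rook_zero)

lemma rook_unit_inv:
  assumes "i < n" "j < n" "a \<in> carrier G"
  shows "sg_inv (rook_mat n (group_zero G)) (rook_unit n i j a) = rook_unit n j i (inv a)"
  unfolding rook_inv_eq[OF rook_unit_closed[OF assms(3)]]
proof (rule mat_option_eqI[where n = n])
  fix r s c assume "r < n" "s < n"
  then show "rook_inv n (rook_unit n i j a) $$ (r, s) = Some c \<longleftrightarrow> rook_unit n j i (inv a) $$ (r, s) = Some c"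
    by (auto simp: rook_inv_eq_Some rook_unit_eq_Some)
qed (auto simp: rook_unit_def rook_inv_def)

text \<open>Matrix units cut out single entries; this turns statements about entries into statements about
products, which homomorphisms respect.\<close>

lemma rook_unit_compress:
  assumes A: "A \<in> carrier (rook_mat n (group_zero G))" and "i < n" "j < n" "k < n" "l < n"
  shows "rook_unit n k i \<one> \<cdot>\<^bsub>rook_mat n (group_zero G)\<^esub> (A \<cdot>\<^bsub>rook_mat n (group_zero G)\<^esub> rook_unit n j l \<one>) =
    (case A $$ (i, j) of None \<Rightarrow> sg_zero (rook_mat n (group_zero G)) | Some a \<Rightarrow> rook_unit n k l a)"
    (is "?L = ?R")
proof (rule mat_option_eqI[where n = n])
  fix r s c assume rs: "r < n" "s < n"
  have 1: "rook_unit n k i \<one> \<in> carrier (rook_mat n (group_zero G))" "rook_unit n j l \<one> \<in> carrier (rook_mat n (group_zero G))"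
    by simp_all
  have "?L $$ (r, s) = Some c \<longleftrightarrow> r = k \<and> s = l \<and> A $$ (i, j) = Some c"
    using assms rs rook_entry_closed[OF A, of i j]
    by (auto simp: rook_mult_eq_Some[OF 1(1) rook_mult_closed[OF A 1(2)]] rook_mult_eq_Some[OF A 1(2)]
      rook_unit_eq_Some cong: conj_cong, intro exI[of _ c] conjI exI[of _ j], auto)
  moreover have "?R $$ (r, s) = Some c \<longleftrightarrow> r = k \<and> s = l \<and> A $$ (i, j) = Some c"
    using rs by (auto simp: rook_unit_eq_Some rook_zero split: option.split)
  ultimately show "?L $$ (r, s) = Some c \<longleftrightarrow> ?R $$ (r, s) = Some c" by simp
qed (auto simp: rook_unit_def rook_zero split: option.split)

lemma rook_unit_nonzero: "\<lbrakk>i < n; j < n\<rbrakk> \<Longrightarrow> rook_unit n i j a \<noteq> sg_zero (rook_mat n (group_zero G))"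
  using rook_unit_eq_Some[of i n j i j a a] by (auto simp: rook_zero)

end

section \<open>Maximal subgroups\<close>

definition max_subgroup :: "('a, 'm) semigroup_zero_scheme \<Rightarrow> 'a \<Rightarrow> 'a monoid" where
  "max_subgroup S e =
     \<lparr>carrier = {x \<in> carrier S. sg_dom S x = e \<and> sg_ran S x = e}, mult = sg_mult S, one = e\<rparr>"

lemma max_subgroup_simps [simp]:
  "mult (max_subgroup S e) = sg_mult S" "one (max_subgroup S e) = e"
  by (simp_all add: max_subgroup_def)

context inverse_semigroup_zero
begin

lemma in_max_subgroup_iff:
  "x \<in> carrier (max_subgroup S e) \<longleftrightarrow> x \<in> carrier S \<and> x\<^sup>\<star> \<cdot> x = e \<and> x \<cdot> x\<^sup>\<star> = e"
  by (simp add: max_subgroup_def sg_dom_def sg_ran_def)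

lemma max_subgroup_closed: "x \<in> carrier (max_subgroup S e) \<Longrightarrow> x \<in> carrier S"
  by (simp add: in_max_subgroup_iff)

lemma max_subgroup_unit:
  assumes "x \<in> carrier (max_subgroup S e)"
  shows "e \<cdot> x = x" "x \<cdot> e = x"
proof -
  have x: "x \<in> carrier S" "e = x\<^sup>\<star> \<cdot> x" "e = x \<cdot> x\<^sup>\<star>" using assms by (auto simp: in_max_subgroup_iff)
  show "e \<cdot> x = x" using x(1) unfolding x(3) by simp
  show "x \<cdot> e = x" using x(1) unfolding x(2) by simp
qed

lemma max_subgroup_inv_closed:
  "x \<in> carrier (max_subgroup S e) \<Longrightarrow> x\<^sup>\<star> \<in> carrier (max_subgroup S e)"
  by (auto simp: in_max_subgroup_iff)

lemma max_subgroup_mult_closed: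
  assumes x: "x \<in> carrier (max_subgroup S e)" and y: "y \<in> carrier (max_subgroup S e)"
  shows "x \<cdot> y \<in> carrier (max_subgroup S e)"
proof -
  have [simp]: "x \<in> carrier S" "y \<in> carrier S" using x y by (auto intro: max_subgroup_closed)
  have xx: "x\<^sup>\<star> \<cdot> x = e" "x \<cdot> x\<^sup>\<star> = e" and yy: "y\<^sup>\<star> \<cdot> y = e" "y \<cdot> y\<^sup>\<star> = e"
    using x y by (auto simp: in_max_subgroup_iff)
  have [simp]: "e \<in> carrier S" using xx(1) by auto
  have "(x \<cdot> y)\<^sup>\<star> \<cdot> (x \<cdot> y) = y\<^sup>\<star> \<cdot> ((x\<^sup>\<star> \<cdot> x) \<cdot> y)" by simp
  also have "\<dots> = e" by (simp only: xx max_subgroup_unit[OF y] yy)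
  moreover have "(x \<cdot> y) \<cdot> (x \<cdot> y)\<^sup>\<star> = x \<cdot> ((y \<cdot> y\<^sup>\<star>) \<cdot> x\<^sup>\<star>)" by simp
  moreover have "\<dots> = e"
    by (simp only: yy max_subgroup_unit[OF max_subgroup_inv_closed[OF x]] xx)
  ultimately show ?thesis unfolding in_max_subgroup_iff by simp
qed

lemma group_max_subgroup:
  assumes e: "e \<in> Idp S"
  shows "group (max_subgroup S e)"
proof (rule groupI)
  show "\<one>\<^bsub>max_subgroup S e\<^esub> \<in> carrier (max_subgroup S e)"
    using e by (simp add: in_max_subgroup_iff)
next
  fix x assume x: "x \<in> carrier (max_subgroup S e)"
  show "\<exists>y\<in>carrier (max_subgroup S e). y \<otimes>\<^bsub>max_subgroup S e\<^esub> x = \<one>\<^bsub>max_subgroup S e\<^esub>"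
    using max_subgroup_inv_closed[OF x] x by (intro bexI[of _ "x\<^sup>\<star>"]) (auto simp: in_max_subgroup_iff)
qed (simp_all add: max_subgroup_unit max_subgroup_mult_closed max_subgroup_closed[of _ e])

end

section \<open>Embedding rook matrices along a system of matrix units\<close>

text \<open>Partial isometries \<open>f\<^sub>0, \<dots>, f\<^sub>n\<^sub>-\<^sub>1\<close> with common domain \<open>e\<close> and pairwise orthogonal ranges. The products
\<open>f\<^sub>i f\<^sub>j\<^sup>-\<^sup>1\<close> form a system of matrix units with corner \<open>e\<close>, which is enough to embed the rook matrices
over the maximal subgroup at \<open>e\<close>.\<close>

locale matrix_frame = boolean_inverse_semigroup +
  fixes n :: nat and e and f :: "nat \<Rightarrow> 'a"
  assumes e_Idp [simp]: "e \<in> Idp S"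
    and e_nonzero: "e \<noteq> \<^bold>0"
    and f_closed [simp]: "i < n \<Longrightarrow> f i \<in> carrier S"
    and f_dom: "i < n \<Longrightarrow> (f i)\<^sup>\<star> \<cdot> f i = e"
    and f_orth: "\<lbrakk>i < n; j < n; i \<noteq> j\<rbrakk> \<Longrightarrow> (f i)\<^sup>\<star> \<cdot> f j = \<^bold>0"
begin

abbreviation corner_group ("H") where "H \<equiv> max_subgroup S e"

lemmas H_closed [simp] = max_subgroup_closed[of _ e]
lemmas H_unit [simp] = max_subgroup_unit[of _ e]

sublocale H: group H by (rule group_max_subgroup) simp

lemma H_unit' [simp]: "\<lbrakk>x \<in> carrier H; y \<in> carrier S\<rbrakk> \<Longrightarrow> e \<cdot> (x \<cdot> y) = x \<cdot> y"
  using mult_assoc[of e x y] by simp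

lemma H_nonzero: "x \<in> carrier H \<Longrightarrow> x \<noteq> \<^bold>0"
  using e_nonzero by (auto simp: in_max_subgroup_iff)

lemma frame_product:
  assumes "i < n" "j < n" "y \<in> carrier S"
  shows "(f i)\<^sup>\<star> \<cdot> (f j \<cdot> y) = (if i = j then e \<cdot> y else \<^bold>0)"
  using assms mult_assoc[of "(f i)\<^sup>\<star>" "f j" y, symmetric] by (simp add: f_dom f_orth del: mult_assoc)

text \<open>The image of the matrix whose only nonzero entry is \<open>x\<close>, in position \<open>(i, j)\<close>.\<close>

definition cell :: "nat \<Rightarrow> nat \<Rightarrow> 'a \<Rightarrow> 'a" where
  "cell i j x = f i \<cdot> (x \<cdot> (f j)\<^sup>\<star>)"

lemma cell_closed [simp]: "\<lbrakk>i < n; j < n; x \<in> carrier H\<rbrakk> \<Longrightarrow> cell i j x \<in> carrier S"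
  by (simp add: cell_def)

lemma cell_mult:
  assumes "i < n" "j < n" "k < n" "l < n" "x \<in> carrier H" "y \<in> carrier H"
  shows "cell i k x \<cdot> cell l j y = (if k = l then cell i j (x \<cdot> y) else \<^bold>0)"
  using assms by (simp add: cell_def frame_product)

lemma cell_inv:
  "\<lbrakk>i < n; j < n; x \<in> carrier H\<rbrakk> \<Longrightarrow> (cell i j x)\<^sup>\<star> = cell j i (x\<^sup>\<star>)"
  by (simp add: cell_def)

lemma cell_entry:
  assumes "i < n" "j < n" "k < n" "l < n" "x \<in> carrier H"
  shows "(f i)\<^sup>\<star> \<cdot> (cell k l x \<cdot> f j) = (if i = k \<and> l = j then x else \<^bold>0)"
  using assms by (auto simp: cell_def frame_product f_dom f_orth)

definition cells :: "'a option mat \<Rightarrow> 'a set" where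
  "cells A = {cell i j x |i j x. i < n \<and> j < n \<and> A $$ (i, j) = Some x}"

abbreviation rooks ("R\<^sub>H") where "R\<^sub>H \<equiv> rook_mat n (group_zero H)"

lemma cellsE:
  assumes "A \<in> carrier R\<^sub>H" "c \<in> cells A"
  obtains i j x where "i < n" "j < n" "A $$ (i, j) = Some x" "x \<in> carrier H" "c = cell i j x"
  using assms H.rook_entry_closed[OF assms(1)] unfolding cells_def by blast

lemma cells_closed: "A \<in> carrier R\<^sub>H \<Longrightarrow> cells A \<subseteq> carrier S"
  by (auto elim: cellsE)

lemma cellsI: "\<lbrakk>i < n; j < n; A $$ (i, j) = Some x\<rbrakk> \<Longrightarrow> cell i j x \<in> cells A"
  unfolding cells_def by blast

text \<open>The join exists because distinct nonzero entries of a rook matrix lie in different rows and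
different columns, so their cells are orthogonal.\<close>

definition embed :: "'a option mat \<Rightarrow> 'a" where
  "embed A = \<Squnion>\<^bsub>nat_order S\<^esub>(cells A)"

lemma embed_is_join:
  assumes A: "A \<in> carrier R\<^sub>H"
  shows "is_join (cells A) (embed A)"
proof -
  have "cells A \<subseteq> (\<lambda>(i, j). cell i j (the (A $$ (i, j)))) ` ({..<n} \<times> {..<n})"
  proof
    fix c assume "c \<in> cells A"
    then obtain i j x where "i < n" "j < n" "A $$ (i, j) = Some x" "c = cell i j x"
      by (rule cellsE[OF A])
    then show "c \<in> (\<lambda>(i, j). cell i j (the (A $$ (i, j)))) ` ({..<n} \<times> {..<n})"
      by (intro image_eqI[of _ _ "(i, j)"]) auto
  qed
  then have "finite (cells A)" by (rule finite_subset) simp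
  moreover have "orth S c d" if c: "c \<in> cells A" and d: "d \<in> cells A" and "c \<noteq> d" for c d
  proof -
    obtain i j x where 1: "i < n" "j < n" "A $$ (i, j) = Some x" "x \<in> carrier H" "c = cell i j x"
      using c by (rule cellsE[OF A])
    obtain k l y where 2: "k < n" "l < n" "A $$ (k, l) = Some y" "y \<in> carrier H" "d = cell k l y"
      using d by (rule cellsE[OF A])
    have "i \<noteq> k \<and> j \<noteq> l"
      using H.rook_row_unique[OF A 1(3), of l y] H.rook_col_unique[OF A 1(3), of k y] 1 2 \<open>c \<noteq> d\<close>
      by (cases "i = k"; cases "j = l") auto
    then show ?thesis
      using 1 2 max_subgroup_inv_closed by (simp add: orth_def cell_inv cell_mult)
  qed
  ultimately obtain s where "is_join (cells A) s"
    using finite_orthogonal_join_exists cells_closed[OF A] by blast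
  then show ?thesis unfolding embed_def using sup_eq[OF cells_closed[OF A]] by simp
qed

lemma embed_closed [simp]: "A \<in> carrier R\<^sub>H \<Longrightarrow> embed A \<in> carrier S"
  using embed_is_join by (simp add: is_join_def)

lemma cells_cover_embed: "A \<in> carrier R\<^sub>H \<Longrightarrow> covers (cells A) (embed A)"
  by (rule is_join_covers[OF embed_is_join cells_closed])

text \<open>Compressing by \<open>f\<^sub>i\<^sup>-\<^sup>1\<close> and \<open>f\<^sub>j\<close> kills every cell except the one in position \<open>(i, j)\<close>. So a matrix can
be read off from its image; this gives injectivity, and later the compatibility with \<open>\<phi>\<close>.\<close>

lemma embed_entry:
  assumes A: "A \<in> carrier R\<^sub>H" and ij: "i < n" "j < n"
  shows "(f i)\<^sup>\<star> \<cdot> (embed A \<cdot> f j) = (case A $$ (i, j) of None \<Rightarrow> \<^bold>0 | Some x \<Rightarrow> x)"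
proof -
  let ?s = "(f i)\<^sup>\<star> \<cdot> (embed A \<cdot> f j)"
  define E where "E = (\<lambda>x. (f i)\<^sup>\<star> \<cdot> x) ` (\<lambda>x. x \<cdot> f j) ` cells A"
  have cov: "covers E ?s" unfolding E_def
    by (intro covers_mult_left covers_mult_right cells_cover_embed A) (use ij in simp_all)
  have E: "y = \<^bold>0 \<or> A $$ (i, j) = Some y" if yE: "y \<in> E" for y
  proof -
    obtain c where c: "c \<in> cells A" and y: "y = (f i)\<^sup>\<star> \<cdot> (c \<cdot> f j)"
      using yE unfolding E_def by blast
    obtain k l x where "k < n" "l < n" "A $$ (k, l) = Some x" "x \<in> carrier H" "c = cell k l x"
      using c by (rule cellsE[OF A])
    then show ?thesis using ij y by (auto simp: cell_entry)
  qed
  show ?thesis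
  proof (cases "A $$ (i, j)")
    case None
    then have "E \<subseteq> {\<^bold>0}" using E by auto
    then show ?thesis using covers_zero[OF cov] None by simp
  next
    case (Some x)
    then have x: "x \<in> carrier H" using H.rook_entry_closed[OF A] ij by blast
    have "(f i)\<^sup>\<star> \<cdot> (cell i j x \<cdot> f j) \<in> E" unfolding E_def using cellsI[OF ij Some] by blast
    then have "x \<in> E" using x ij by (simp add: cell_entry)
    then have "covers {x} ?s" using covers_drop_zero[OF cov, of "{x}"] E Some by fastforce
    moreover have "is_join {x} x" using x by (simp add: is_join_def)
    ultimately have "?s = x" by (rule covers_eq_join)
    then show ?thesis using Some by simp
  qed
qed

lemma inj_on_embed: "inj_on embed (carrier R\<^sub>H)"
proof (rule inj_onI)
  fix A B assume A: "A \<in> carrier R\<^sub>H" and B: "B \<in> carrier R\<^sub>H" and eq: "embed A = embed B"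
  show "A = B"
  proof (rule mat_option_eqI)
    fix i j c assume ij: "i < n" "j < n"
    have "(case A $$ (i, j) of None \<Rightarrow> \<^bold>0 | Some x \<Rightarrow> x) = (case B $$ (i, j) of None \<Rightarrow> \<^bold>0 | Some x \<Rightarrow> x)"
      using embed_entry[OF A ij] embed_entry[OF B ij] eq by simp
    moreover have "x \<noteq> \<^bold>0" if "A $$ (i, j) = Some x \<or> B $$ (i, j) = Some x" for x
      using that H.rook_entry_closed[OF A _ ij] H.rook_entry_closed[OF B _ ij] H_nonzero by blast
    ultimately show "A $$ (i, j) = Some c \<longleftrightarrow> B $$ (i, j) = Some c"
      by (cases "A $$ (i, j)"; cases "B $$ (i, j)") auto
  qed (use A B H.rook_carrier_mat in auto)
qed

text \<open>The products of cells of \<open>A\<close> with cells of \<open>B\<close> are dense in the product of the two joins, and apart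
from zero they are exactly the cells of the product matrix.\<close>

lemma embed_mult:
  assumes A: "A \<in> carrier R\<^sub>H" and B: "B \<in> carrier R\<^sub>H"
  shows "embed (A \<cdot>\<^bsub>R\<^sub>H\<^esub> B) = embed A \<cdot> embed B"
proof -
  note AB = H.rook_mult_closed[OF A B]
  let ?P = "\<Union>x\<in>cells A. (\<lambda>y. x \<cdot> y) ` cells B"
  have "covers ?P (embed A \<cdot> embed B)"
  proof (rule covers_Union)
    show "covers ((\<lambda>x. x \<cdot> embed B) ` cells A) (embed A \<cdot> embed B)"
      using A B by (intro covers_mult_right cells_cover_embed) simp_all
    fix x assume "x \<in> cells A"
    then show "covers ((\<lambda>y. x \<cdot> y) ` cells B) (x \<cdot> embed B)"
      using cells_closed[OF A] B by (intro covers_mult_left cells_cover_embed) auto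
  qed
  moreover have "cells (A \<cdot>\<^bsub>R\<^sub>H\<^esub> B) \<subseteq> ?P"
  proof
    fix c assume "c \<in> cells (A \<cdot>\<^bsub>R\<^sub>H\<^esub> B)"
    then obtain i j z where ij: "i < n" "j < n" and z: "(A \<cdot>\<^bsub>R\<^sub>H\<^esub> B) $$ (i, j) = Some z" "c = cell i j z"
      by (rule cellsE[OF AB])
    then obtain k x y where k: "k < n" "A $$ (i, k) = Some x" "B $$ (k, j) = Some y" "z = x \<cdot> y"
      by (auto simp: H.rook_mult_eq_Some[OF A B])
    have "x \<in> carrier H" "y \<in> carrier H"
      using H.rook_entry_closed[OF A k(2)] H.rook_entry_closed[OF B k(3)] ij k by auto
    then have "c = cell i k x \<cdot> cell k j y" using ij k z by (simp add: cell_mult)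
    then show "c \<in> ?P" using cellsI[of i k A x] cellsI[of k j B y] ij k by blast
  qed
  moreover have "?P \<subseteq> insert \<^bold>0 (cells (A \<cdot>\<^bsub>R\<^sub>H\<^esub> B))"
  proof
    fix c assume "c \<in> ?P"
    then obtain a b where a: "a \<in> cells A" and b: "b \<in> cells B" and c: "c = a \<cdot> b" by blast
    obtain i k x where 1: "i < n" "k < n" "A $$ (i, k) = Some x" "x \<in> carrier H" "a = cell i k x"
      using a by (rule cellsE[OF A])
    obtain l j y where 2: "l < n" "j < n" "B $$ (l, j) = Some y" "y \<in> carrier H" "b = cell l j y"
      using b by (rule cellsE[OF B])
    show "c \<in> insert \<^bold>0 (cells (A \<cdot>\<^bsub>R\<^sub>H\<^esub> B))"
    proof (cases "k = l")
      case True
      then have "(A \<cdot>\<^bsub>R\<^sub>H\<^esub> B) $$ (i, j) = Some (x \<cdot> y)"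
        using 1 2 by (auto simp: H.rook_mult_eq_Some[OF A B])
      then have "cell i j (x \<cdot> y) \<in> cells (A \<cdot>\<^bsub>R\<^sub>H\<^esub> B)" using 1 2 by (intro cellsI)
      then show ?thesis using True 1 2 c by (simp add: cell_mult)
    qed (use 1 2 c in \<open>simp add: cell_mult\<close>)
  qed
  ultimately have "covers (cells (A \<cdot>\<^bsub>R\<^sub>H\<^esub> B)) (embed A \<cdot> embed B)" by (rule covers_drop_zero)
  then show ?thesis using covers_eq_join embed_is_join[OF AB] by metis
qed

lemma embed_zero: "embed (sg_zero R\<^sub>H) = \<^bold>0"
proof (rule covers_zero)
  interpret RH: inverse_semigroup_zero "R\<^sub>H" by (rule H.inverse_semigroup_rook_mat)
  show "covers (cells (sg_zero R\<^sub>H)) (embed (sg_zero R\<^sub>H))"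
    by (rule cells_cover_embed) simp
qed (auto simp: cells_def H.rook_zero)

lemma embed_orth_join:
  assumes A: "A \<in> carrier R\<^sub>H" and B: "B \<in> carrier R\<^sub>H" and orth: "orth R\<^sub>H A B"
  shows "embed (orth_join R\<^sub>H A B) = orth_join S (embed A) (embed B)"
proof -
  note J = H.rook_orth_join[OF A B orth]
  have "cells (rook_overlay n A B) = cells A \<union> cells B"
    unfolding cells_def by (auto simp: J(3) cong: conj_cong)
  then have "is_join (cells A \<union> cells B) (embed (rook_overlay n A B))"
    using embed_is_join[OF J(2)] by simp
  then have "is_join {embed A, embed B} (embed (rook_overlay n A B))"
    by (rule is_join_Un[OF embed_is_join[OF A] embed_is_join[OF B]]) (auto intro: cells_closed A B del: subsetI)
  then show ?thesis unfolding J(1) using A B by (intro orth_join_eq[symmetric]) simp_all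
qed

theorem embed_bias_embedding: "embed \<in> bias_embedding R\<^sub>H S"
  unfolding bias_embedding_def bias_hom_def
  using embed_mult embed_zero embed_orth_join inj_on_embed by simp

end

section \<open>Lifting matrix units along a surjection\<close>

lemma mult_hom_preserves_inv:
  assumes S: "inverse_semigroup_zero S" and T: "inverse_semigroup_zero T"
    and closed: "\<And>x. x \<in> carrier S \<Longrightarrow> h x \<in> carrier T"
    and mult: "\<And>x y. \<lbrakk>x \<in> carrier S; y \<in> carrier S\<rbrakk> \<Longrightarrow> h (x \<cdot>\<^bsub>S\<^esub> y) = h x \<cdot>\<^bsub>T\<^esub> h y"
    and x: "x \<in> carrier S"
  shows "h (sg_inv S x) = sg_inv T (h x)"
proof -
  interpret S: inverse_semigroup_zero S by fact
  interpret T: inverse_semigroup_zero T by fact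
  have "h x = h (x \<cdot>\<^bsub>S\<^esub> sg_inv S x \<cdot>\<^bsub>S\<^esub> x)" using x by simp
  also have "\<dots> = h x \<cdot>\<^bsub>T\<^esub> h (sg_inv S x) \<cdot>\<^bsub>T\<^esub> h x"
    using x by (simp only: mult S.inv_closed S.mult_closed)
  finally have 1: "h x = h x \<cdot>\<^bsub>T\<^esub> h (sg_inv S x) \<cdot>\<^bsub>T\<^esub> h x" .
  have "h (sg_inv S x) = h (sg_inv S x \<cdot>\<^bsub>S\<^esub> x \<cdot>\<^bsub>S\<^esub> sg_inv S x)" using x by simp
  also have "\<dots> = h (sg_inv S x) \<cdot>\<^bsub>T\<^esub> h x \<cdot>\<^bsub>T\<^esub> h (sg_inv S x)"
    using x by (simp only: mult S.inv_closed S.mult_closed)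
  finally have "is_inverse T (h x) (h (sg_inv S x))"
    unfolding is_inverse_def using 1 closed[OF S.inv_closed[OF x]] by blast
  then show ?thesis using T.inv_eqI closed x by simp
qed

locale rook_surjection = boolean_inverse_semigroup S + G: group G
  for S (structure) and G (structure) +
  fixes n :: nat and \<phi> :: "'a \<Rightarrow> 'c option mat"
  assumes n_pos: "n > 0"
    and hom: "\<phi> \<in> bias_hom S (rook_mat n (group_zero G))"
    and surj: "\<phi> ` carrier S = carrier (rook_mat n (group_zero G))"
begin

abbreviation rooks ("R\<^sub>G") where "R\<^sub>G \<equiv> rook_mat n (group_zero G)"
abbreviation E where "E i j \<equiv> rook_unit n i j \<one>\<^bsub>G\<^esub>"

sublocale R: inverse_semigroup_zero "R\<^sub>G" by (rule G.inverse_semigroup_rook_mat)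

lemma phi_closed [simp]: "x \<in> carrier S \<Longrightarrow> \<phi> x \<in> carrier R\<^sub>G"
  using surj by blast

lemma phi_mult [simp]: "\<lbrakk>x \<in> carrier S; y \<in> carrier S\<rbrakk> \<Longrightarrow> \<phi> (x \<cdot> y) = \<phi> x \<cdot>\<^bsub>R\<^sub>G\<^esub> \<phi> y"
  using hom by (simp add: bias_hom_def)

lemma phi_zero [simp]: "\<phi> \<^bold>0 = sg_zero R\<^sub>G"
  using hom by (simp add: bias_hom_def)

lemma phi_inv [simp]: "x \<in> carrier S \<Longrightarrow> \<phi> (x\<^sup>\<star>) = sg_inv R\<^sub>G (\<phi> x)"
  by (rule mult_hom_preserves_inv) (unfold_locales, simp_all)

text \<open>This is the way in which preservation of orthogonal joins is used: a summand in the kernel does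
not change the image.\<close>

lemma phi_orth_join_null:
  assumes "x \<in> carrier S" "y \<in> carrier S" "orth S x y" "\<phi> y = sg_zero R\<^sub>G"
  shows "\<phi> (orth_join S x y) = \<phi> x"
  using hom assms R.orth_join_zero_right[of "\<phi> x"] by (simp add: bias_hom_def)

text \<open>Orthogonal idempotents lift one at a time: replace \<open>b\<close> by the complement of \<open>b a\<close> in \<open>b\<close>. The image
does not change, since \<open>b a\<close> is sent to zero.\<close>

lemma disjoint_lift:
  assumes a: "a \<in> Idp S" and b: "b \<in> Idp S" and ba: "\<phi> b \<cdot>\<^bsub>R\<^sub>G\<^esub> \<phi> a = sg_zero R\<^sub>G"
  obtains c where "c \<in> Idp S" "c \<preceq> b" "c \<cdot> a = \<^bold>0" "\<phi> c = \<phi> b"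
proof -
  have "b \<cdot> a \<preceq> b" using a b by simp
  then obtain c where c: "c \<in> Idp S" "b \<cdot> a \<cdot> c = \<^bold>0" "c \<preceq> b" "orth_join S (b \<cdot> a) c = b"
    using Idp_orth_complement[of "b \<cdot> a" b] a b Idp_mult by metis
  have bc: "b \<cdot> c = c" using c b by (simp add: Idp_nat_le_iff)
  have "c \<cdot> a = a \<cdot> (b \<cdot> c)" using a c by (simp add: bc Idp_commute)
  also have "\<dots> = b \<cdot> a \<cdot> c" using a b c by (simp add: Idp_left_commute[of a b])
  finally have ca: "c \<cdot> a = \<^bold>0" using c by simp
  have "orth S c (b \<cdot> a)" using a b c Idp_commute[of c "b \<cdot> a"] by (simp add: Idp_orth_iff)
  then have "\<phi> (orth_join S c (b \<cdot> a)) = \<phi> c" using a b c ba by (intro phi_orth_join_null) simp_all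
  then have "\<phi> c = \<phi> b" using c(4) by (simp add: orth_join_commute)
  with c ca that show ?thesis by blast
qed

lemma disjoint_lift_finite:
  assumes "finite F" "F \<subseteq> Idp S" and b: "b \<in> Idp S"
    and "\<And>a. a \<in> F \<Longrightarrow> \<phi> b \<cdot>\<^bsub>R\<^sub>G\<^esub> \<phi> a = sg_zero R\<^sub>G"
  shows "\<exists>c\<in>Idp S. (\<forall>a\<in>F. c \<cdot> a = \<^bold>0) \<and> \<phi> c = \<phi> b"
  using assms(1,2,4)
proof (induction F)
  case empty
  then show ?case using b by auto
next
  case (insert a F)
  then obtain c where c: "c \<in> Idp S" "\<And>a. a \<in> F \<Longrightarrow> c \<cdot> a = \<^bold>0" "\<phi> c = \<phi> b" by auto
  have a: "a \<in> Idp S" using insert by simp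
  obtain d where d: "d \<in> Idp S" "d \<preceq> c" "d \<cdot> a = \<^bold>0" "\<phi> d = \<phi> c"
    using disjoint_lift[OF a c(1)] c(3) insert.prems by auto
  have "d \<cdot> a' = \<^bold>0" if "a' \<in> F" for a'
  proof -
    have a': "a' \<in> Idp S" using that insert.prems by auto
    have "d \<cdot> a' = c \<cdot> d \<cdot> a'" using d c by (simp add: Idp_nat_le_iff)
    also have "\<dots> = d \<cdot> (c \<cdot> a')" using a' c d by (simp add: Idp_left_commute[of c d])
    finally show ?thesis using c that d by simp
  qed
  then show ?case using c d by auto
qed

lemma unit_mult:
  "\<lbrakk>i < n; j < n; k < n; l < n\<rbrakk> \<Longrightarrow> E i k \<cdot>\<^bsub>R\<^sub>G\<^esub> E l j = (if k = l then E i j else sg_zero R\<^sub>G)"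
  by (simp add: G.rook_unit_mult)

lemma unit_inv: "\<lbrakk>i < n; j < n\<rbrakk> \<Longrightarrow> sg_inv R\<^sub>G (E i j) = E j i"
  by (simp add: G.rook_unit_inv)

lemma unit_closed [simp]: "E i j \<in> carrier R\<^sub>G"
  by simp

lemma orthogonal_diagonal_lifts:
  "m \<le> n \<Longrightarrow> \<exists>a. (\<forall>i<m. a i \<in> Idp S \<and> \<phi> (a i) = E i i) \<and> (\<forall>i<m. \<forall>j<m. i \<noteq> j \<longrightarrow> a i \<cdot> a j = \<^bold>0)"
proof (induction m)
  case (Suc m)
  then obtain a where a: "\<And>i. i < m \<Longrightarrow> a i \<in> Idp S" "\<And>i. i < m \<Longrightarrow> \<phi> (a i) = E i i"
    "\<And>i j. \<lbrakk>i < m; j < m; i \<noteq> j\<rbrakk> \<Longrightarrow> a i \<cdot> a j = \<^bold>0" by auto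
  obtain x where x: "x \<in> carrier S" "\<phi> x = E m m" using surj unit_closed by (metis imageE)
  have m: "m < n" using Suc by simp
  have xx: "\<phi> (x\<^sup>\<star> \<cdot> x) = E m m" using x m by (simp add: unit_inv unit_mult)
  have null: "E m m \<cdot>\<^bsub>R\<^sub>G\<^esub> \<phi> y = sg_zero R\<^sub>G" if "y \<in> a ` {..<m}" for y
    using that m a by (auto simp: unit_mult)
  have "a ` {..<m} \<subseteq> Idp S" using a by auto
  then have "\<exists>c\<in>Idp S. (\<forall>y\<in>a ` {..<m}. c \<cdot> y = \<^bold>0) \<and> \<phi> c = \<phi> (x\<^sup>\<star> \<cdot> x)"
    using x xx null by (intro disjoint_lift_finite) (simp_all del: phi_mult phi_inv)
  then obtain c where c: "c \<in> Idp S" "\<And>y. y \<in> a ` {..<m} \<Longrightarrow> c \<cdot> y = \<^bold>0" "\<phi> c = E m m"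
    unfolding xx by blast
  have "a i \<cdot> c = \<^bold>0" if "i < m" for i
    using c(2)[of "a i"] that a c(1) Idp_commute[of c "a i"] by simp
  then show ?case using a c
    by (intro exI[of _ "a(m := c)"]) (auto simp: less_Suc_eq)
qed simp

text \<open>Cut a preimage of each unit \<open>E i 0\<close> by orthogonal lifts of the diagonal units, so that the ranges
become orthogonal. The domains still differ, but all are sent to \<open>E 0 0\<close>; their
meet \<open>e\<close> is sent there too, and restricting everything to \<open>e\<close> gives the frame.\<close>

theorem matrix_frame_lifts:
  obtains e f where "matrix_frame S n e f" "\<phi> e = E 0 0" "\<And>i. i < n \<Longrightarrow> \<phi> (f i) = E i 0"
proof -
  obtain a where a: "\<And>i. i < n \<Longrightarrow> a i \<in> Idp S" "\<And>i. i < n \<Longrightarrow> \<phi> (a i) = E i i"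
    "\<And>i j. \<lbrakk>i < n; j < n; i \<noteq> j\<rbrakk> \<Longrightarrow> a i \<cdot> a j = \<^bold>0"
    using orthogonal_diagonal_lifts[of n] by auto
  have "\<forall>i. \<exists>x\<in>carrier S. \<phi> x = E i 0" using surj unit_closed by (metis imageE)
  then obtain x where x: "\<And>i. x i \<in> carrier S" "\<And>i. \<phi> (x i) = E i 0" by metis
  define y where "y i = a i \<cdot> x i \<cdot> a 0" for i
  have y: "y i \<in> carrier S" "\<phi> (y i) = E i 0" if "i < n" for i
    using a that x n_pos by (simp_all add: y_def unit_mult)
  have yy: "(y i)\<^sup>\<star> \<cdot> y j = \<^bold>0" if "i < n" "j < n" "i \<noteq> j" for i j
  proof -
    have "(y i)\<^sup>\<star> \<cdot> y j = a 0 \<cdot> ((x i)\<^sup>\<star> \<cdot> ((a i \<cdot> a j) \<cdot> (x j \<cdot> a 0)))"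
      using a(1) that x n_pos by (simp add: y_def)
    then show ?thesis using a that x n_pos by simp
  qed
  have "\<exists>e\<in>Idp S. \<phi> e = E 0 0 \<and> (\<forall>i<m. e \<preceq> (y i)\<^sup>\<star> \<cdot> y i)" if "m \<le> n" for m
    using that
  proof (induction m)
    case 0
    then show ?case using a n_pos by auto
  next
    case (Suc m)
    then obtain e where e: "e \<in> Idp S" "\<phi> e = E 0 0" "\<And>i. i < m \<Longrightarrow> e \<preceq> (y i)\<^sup>\<star> \<cdot> y i" by auto
    define d where "d = (y m)\<^sup>\<star> \<cdot> y m"
    have d: "d \<in> Idp S" "\<phi> d = E 0 0" using y[of m] Suc.prems n_pos by (auto simp: d_def unit_inv unit_mult)
    have "e \<cdot> d \<preceq> (y i)\<^sup>\<star> \<cdot> y i" if "i < m" for i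
      using nat_le_trans[OF nat_le_mult_Idp e(3)] that e d y[of i] Suc.prems by simp
    moreover have "e \<cdot> d \<preceq> (y m)\<^sup>\<star> \<cdot> y m" using nat_le_Idp_mult[of d e] e d by (simp add: d_def)
    moreover have "\<phi> (e \<cdot> d) = E 0 0" using e d n_pos by (simp add: unit_mult)
    ultimately show ?case using e d by (intro bexI[of _ "e \<cdot> d"]) (auto simp: less_Suc_eq)
  qed
  then obtain e where e: "e \<in> Idp S" "\<phi> e = E 0 0" "\<And>i. i < n \<Longrightarrow> e \<preceq> (y i)\<^sup>\<star> \<cdot> y i" by auto
  define f where "f i = y i \<cdot> e" for i
  have "matrix_frame S n e f"
  proof
    show "e \<noteq> \<^bold>0" using e(2) G.rook_unit_nonzero[of 0 n 0] n_pos phi_zero by metis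
    show "f i \<in> carrier S" if "i < n" for i using that y e by (simp add: f_def)
    show "(f i)\<^sup>\<star> \<cdot> f i = e" if "i < n" for i
    proof -
      have "(y i)\<^sup>\<star> \<cdot> (y i \<cdot> e) = e" using e(3)[OF that] e(1) y[OF that] by (simp add: Idp_nat_le_iff)
      then show ?thesis using that y e by (simp add: f_def)
    qed
    show "(f i)\<^sup>\<star> \<cdot> f j = \<^bold>0" if "i < n" "j < n" "i \<noteq> j" for i j
    proof -
      have "(f i)\<^sup>\<star> \<cdot> f j = e \<cdot> (((y i)\<^sup>\<star> \<cdot> y j) \<cdot> e)" using that y e by (simp add: f_def)
      then show ?thesis using that e by (simp add: yy)
    qed
  qed (rule e)
  moreover have "\<phi> (f i) = E i 0" if "i < n" for i
    using that y e n_pos by (simp add: f_def unit_mult)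
  ultimately show ?thesis using that e by blast
qed

lemma phi_max_subgroup:
  assumes "\<phi> e = E 0 0" "x \<in> carrier (max_subgroup S e)" "e \<in> Idp S"
  obtains g where "g \<in> carrier G" "\<phi> x = rook_unit n 0 0 g"
proof -
  have x: "x \<in> carrier S" "x\<^sup>\<star> \<cdot> x = e" using assms by (auto simp: in_max_subgroup_iff)
  have "\<phi> x = \<phi> (e \<cdot> (x \<cdot> e))" using max_subgroup_unit[OF assms(2)] by simp
  also have "\<dots> = E 0 0 \<cdot>\<^bsub>R\<^sub>G\<^esub> (\<phi> x \<cdot>\<^bsub>R\<^sub>G\<^esub> E 0 0)" using x assms by simp
  also have "\<dots> = (case \<phi> x $$ (0, 0) of None \<Rightarrow> sg_zero R\<^sub>G | Some a \<Rightarrow> rook_unit n 0 0 a)"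
    using x n_pos by (intro G.rook_unit_compress) simp_all
  finally have *: "\<phi> x = (case \<phi> x $$ (0, 0) of None \<Rightarrow> sg_zero R\<^sub>G | Some a \<Rightarrow> rook_unit n 0 0 a)" .
  show ?thesis
  proof (cases "\<phi> x $$ (0, 0)")
    case None
    then have "\<phi> x = sg_zero R\<^sub>G" using * by simp
    then have "\<phi> (x\<^sup>\<star> \<cdot> x) = sg_zero R\<^sub>G" using x(1) by simp
    then have "\<phi> e = sg_zero R\<^sub>G" unfolding x(2) .
    then show ?thesis using assms(1) G.rook_unit_nonzero[of 0 n 0 "\<one>\<^bsub>G\<^esub>"] n_pos by simp
  next
    case (Some g)
    then show ?thesis using * that G.rook_entry_closed[OF phi_closed[OF x(1)], of 0 0 g] n_pos by simp
  qed
qed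

text \<open>A preimage \<open>x\<close> of \<open>g\<close> compressed to the corner has domain \<open>d\<close> and range \<open>r\<close> below \<open>e\<close>, but possibly
smaller. Cancellativity applied to \<open>e = d \<oplus> a = r \<oplus> b\<close> yields \<open>y\<close> with domain \<open>a\<close> and range \<open>b\<close>.
Then \<open>x \<oplus> y\<close> lies in the maximal subgroup, and its image is still \<open>g\<close> because \<open>d\<close> and \<open>e\<close> have the
same image, so that \<open>a\<close>, and with it \<open>y\<close>, is sent to zero.\<close>

lemma max_subgroup_onto:
  assumes canc: "D_cancellative S" and e: "e \<in> Idp S" "\<phi> e = E 0 0" and g: "g \<in> carrier G"
  shows "\<exists>z\<in>carrier (max_subgroup S e). \<phi> z = rook_unit n 0 0 g"
proof -
  obtain x0 where x0: "x0 \<in> carrier S" "\<phi> x0 = rook_unit n 0 0 g"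
    using surj G.rook_unit_closed[OF g] by (metis imageE)
  define x where "x = e \<cdot> (x0 \<cdot> e)"
  have [simp]: "x \<in> carrier S" using x0 e by (simp add: x_def)
  have phix: "\<phi> x = rook_unit n 0 0 g" using x0 e g n_pos by (simp add: x_def G.rook_unit_mult)
  have xe: "x \<cdot> e = x" "e \<cdot> x = x" using x0 e by (simp_all add: x_def)
  define d r where "d = x\<^sup>\<star> \<cdot> x" and "r = x \<cdot> x\<^sup>\<star>"
  have dr [simp]: "d \<in> Idp S" "r \<in> Idp S" by (simp_all add: d_def r_def)
  have xd: "x \<cdot> d = x" and rx: "r \<cdot> x = x" by (simp_all add: d_def r_def)
  have "d \<cdot> e = d" using xe e by (simp add: d_def)
  then have de: "d \<preceq> e" using e by (simp add: Idp_nat_le_iff Idp_commute[of e d])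
  have "e \<cdot> r = r" using xe mult_assoc[of e x "x\<^sup>\<star>"] e by (simp add: r_def)
  then have re: "r \<preceq> e" using e by (simp add: Idp_nat_le_iff)
  obtain a where a: "a \<in> Idp S" "d \<cdot> a = \<^bold>0" "a \<preceq> e" "orth_join S d a = e"
    by (rule Idp_orth_complement[OF dr(1) e(1) de])
  obtain b where b: "b \<in> Idp S" "r \<cdot> b = \<^bold>0" "b \<preceq> e" "orth_join S r b = e"
    by (rule Idp_orth_complement[OF dr(2) e(1) re])
  have "D_rel S d r" unfolding D_rel_def sg_dom_def sg_ran_def d_def r_def by (intro bexI[of _ x]) simp_all
  then have "D_rel S a b"
    using canc a b dr unfolding D_cancellative_def by (metis Idp_orth_iff)
  then obtain y where y [simp]: "y \<in> carrier S" and ya: "y\<^sup>\<star> \<cdot> y = a" and yb: "y \<cdot> y\<^sup>\<star> = b"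
    unfolding D_rel_def sg_dom_def sg_ran_def by blast
  have yy: "y \<cdot> a = y" "b \<cdot> y = y" using ya yb by auto
  have "x\<^sup>\<star> \<cdot> y = \<^bold>0"
  proof -
    have "x\<^sup>\<star> \<cdot> y = (r \<cdot> x)\<^sup>\<star> \<cdot> (b \<cdot> y)" by (simp only: rx yy)
    also have "\<dots> = x\<^sup>\<star> \<cdot> ((r \<cdot> b) \<cdot> y)" using b(1) by simp
    also have "\<dots> = \<^bold>0" by (simp only: b(2)) simp
    finally show ?thesis .
  qed
  moreover have "x \<cdot> y\<^sup>\<star> = \<^bold>0"
  proof -
    have "x \<cdot> y\<^sup>\<star> = (x \<cdot> d) \<cdot> (y \<cdot> a)\<^sup>\<star>" by (simp only: xd yy)
    also have "\<dots> = x \<cdot> ((d \<cdot> a) \<cdot> y\<^sup>\<star>)" using a(1) by simp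
    also have "\<dots> = \<^bold>0" by (simp only: a(2)) simp
    finally show ?thesis .
  qed
  ultimately have orth: "orth S x y" by (simp add: orth_def)
  define z where "z = orth_join S x y"
  have zj: "is_join {x, y} z" using orth_is_join[OF _ _ orth] by (simp add: z_def)
  then have z [simp]: "z \<in> carrier S" and xz: "x \<preceq> z" and yz: "y \<preceq> z" by (auto simp: is_join_def)
  have cov: "covers {x, y} z" using zj by (rule is_join_covers) simp
  have "covers {d, a} (z\<^sup>\<star> \<cdot> z)"
    using covers_mult_left[OF cov, of "z\<^sup>\<star>"] inv_mult_of_nat_le[OF xz] inv_mult_of_nat_le[OF yz]
    by (simp add: d_def ya)
  moreover have "is_join {d, a} e"
    using orth_is_join[of d a] a by (simp add: Idp_orth_iff)
  ultimately have "z\<^sup>\<star> \<cdot> z = e" by (rule covers_eq_join)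
  moreover have "covers {r, b} (z \<cdot> z\<^sup>\<star>)"
    using covers_mult_right[OF cov, of "z\<^sup>\<star>"] mult_inv_of_nat_le[OF xz] mult_inv_of_nat_le[OF yz]
    by (simp add: r_def yb)
  moreover have "is_join {r, b} e"
    using orth_is_join[of r b] b by (simp add: Idp_orth_iff)
  ultimately have "z \<in> carrier (max_subgroup S e)"
    using covers_eq_join by (auto simp: in_max_subgroup_iff)
  moreover have "\<phi> z = rook_unit n 0 0 g"
  proof -
    have "\<phi> d = E 0 0" using g n_pos phix by (simp add: d_def G.rook_unit_inv G.rook_unit_mult)
    have ae: "a \<cdot> e = a" using a e Idp_commute[of a e] by (simp add: Idp_nat_le_iff)
    have "\<phi> a = \<phi> (a \<cdot> e)" by (simp only: ae)
    also have "\<dots> = \<phi> (a \<cdot> d)" using a e \<open>\<phi> d = E 0 0\<close> by simp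
    also have "\<dots> = \<phi> (d \<cdot> a)" by (simp only: Idp_commute[OF a(1) dr(1)])
    finally have "\<phi> a = sg_zero R\<^sub>G" by (simp only: a(2) phi_zero)
    then have "\<phi> y = sg_zero R\<^sub>G" using phi_mult[of y a] a yy by simp
    then show ?thesis using phi_orth_join_null[OF _ _ orth] phix by (simp add: z_def)
  qed
  ultimately show ?thesis by blast
qed

end

section \<open>The lifting theorem\<close>

theorem lemma8p3:
  fixes S :: "'s semigroup_zero" and G :: "'g monoid" and n :: nat
    and \<phi> :: "'s \<Rightarrow> 'g option mat"
  assumes "boolean_inverse_semigroup S"
    and "D_cancellative S"
    and "n > 0"
    and "group G"
    and "\<phi> \<in> bias_hom S (rook_mat n (group_zero G))"
    and "\<phi> ` carrier S = carrier (rook_mat n (group_zero G))"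
  shows "\<exists>(G' :: 's monoid) (\<psi> :: 's \<Rightarrow> 'g) (\<eta> :: 's option mat \<Rightarrow> 's).
           group G' \<and>
           \<psi> \<in> epi G' G \<and>
           \<eta> \<in> bias_embedding (rook_mat n (group_zero G')) S \<and>
           (\<forall>A \<in> carrier (rook_mat n (group_zero G')). map_mat (map_option \<psi>) A = \<phi> (\<eta> A))"
proof -
  interpret rook_surjection S G n \<phi>
    using assms unfolding rook_surjection_def rook_surjection_axioms_def by blast
  obtain e f where frame: "matrix_frame S n e f" and e: "\<phi> e = E 0 0" and f: "\<And>i. i < n \<Longrightarrow> \<phi> (f i) = E i 0"
    using matrix_frame_lifts by metis
  interpret F: matrix_frame S n e f by (rule frame)
  let ?H = "max_subgroup S e"
  define \<psi> where "\<psi> x = the (\<phi> x $$ (0, 0))" for x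
  have unit00: "rook_unit n 0 0 g $$ (0, 0) = Some g" for g
    using n_pos by (simp add: rook_unit_eq_Some)
  have psi: "\<psi> x \<in> carrier G" "\<phi> x = rook_unit n 0 0 (\<psi> x)" if x: "x \<in> carrier ?H" for x
  proof -
    obtain g where "g \<in> carrier G" "\<phi> x = rook_unit n 0 0 g"
      using phi_max_subgroup[OF e x F.e_Idp] by blast
    then show "\<psi> x \<in> carrier G" "\<phi> x = rook_unit n 0 0 (\<psi> x)" by (simp_all add: \<psi>_def unit00)
  qed
  have "\<psi> \<in> epi ?H G"
    unfolding epi_iff_subset
  proof
    show "\<psi> \<in> hom ?H G"
    proof (rule homI)
      fix x y assume xy: "x \<in> carrier ?H" "y \<in> carrier ?H"
      have "\<phi> (x \<cdot>\<^bsub>S\<^esub> y) = rook_unit n 0 0 (\<psi> x \<otimes>\<^bsub>G\<^esub> \<psi> y)"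
        using xy psi[OF xy(1)] psi[OF xy(2)] n_pos by (simp add: G.rook_unit_mult)
      then show "\<psi> (x \<otimes>\<^bsub>?H\<^esub> y) = \<psi> x \<otimes>\<^bsub>G\<^esub> \<psi> y" by (simp add: \<psi>_def[of "x \<cdot>\<^bsub>S\<^esub> y"] unit00)
    qed (rule psi)
    show "carrier G \<subseteq> \<psi> ` carrier ?H"
    proof
      fix g assume "g \<in> carrier G"
      then obtain z where "z \<in> carrier ?H" "\<phi> z = rook_unit n 0 0 g"
        using max_subgroup_onto[OF assms(2) F.e_Idp e] by blast
      then show "g \<in> \<psi> ` carrier ?H" by (intro image_eqI[of _ _ z]) (simp_all add: \<psi>_def unit00)
    qed
  qed
  moreover have "map_mat (map_option \<psi>) A = \<phi> (F.embed A)"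
    if A: "A \<in> carrier (rook_mat n (group_zero ?H))" for A
  proof (rule eq_matI)
    have Ac: "A \<in> carrier_mat n n" by (rule F.H.rook_carrier_mat[OF A])
    have Bc: "\<phi> (F.embed A) \<in> carrier_mat n n" using A by (intro G.rook_carrier_mat) simp
    show "dim_row (map_mat (map_option \<psi>) A) = dim_row (\<phi> (F.embed A))"
      "dim_col (map_mat (map_option \<psi>) A) = dim_col (\<phi> (F.embed A))" using Ac Bc by auto
    fix i j assume "i < dim_row (\<phi> (F.embed A))" "j < dim_col (\<phi> (F.embed A))"
    then have ij: "i < n" "j < n" using Bc by auto
    let ?M = "\<phi> (F.embed A)"
    have "?M $$ (i, j) = (case ?M $$ (i, j) of None \<Rightarrow> sg_zero R\<^sub>G | Some a \<Rightarrow> rook_unit n 0 0 a) $$ (0, 0)"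
      using n_pos by (simp add: unit00 G.rook_zero split: option.split)
    also have "\<dots> = (E 0 i \<cdot>\<^bsub>R\<^sub>G\<^esub> (?M \<cdot>\<^bsub>R\<^sub>G\<^esub> E j 0)) $$ (0, 0)"
      using G.rook_unit_compress[of ?M n i j 0 0] A ij n_pos by simp
    also have "\<dots> = \<phi> (sg_inv S (f i) \<cdot>\<^bsub>S\<^esub> (F.embed A \<cdot>\<^bsub>S\<^esub> f j)) $$ (0, 0)"
      using A ij n_pos f by (simp add: unit_inv)
    also have "\<dots> = \<phi> (case A $$ (i, j) of None \<Rightarrow> sg_zero S | Some x \<Rightarrow> x) $$ (0, 0)"
      by (simp only: F.embed_entry[OF A ij])
    also have "\<dots> = map_option \<psi> (A $$ (i, j))"
      using psi(2) F.H.rook_entry_closed[OF A _ ij] n_pos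
      by (cases "A $$ (i, j)") (auto simp: G.rook_zero unit00)
    finally show "map_mat (map_option \<psi>) A $$ (i, j) = ?M $$ (i, j)" using Ac ij by simp
  qed
  ultimately show ?thesis
    using F.embed_bias_embedding F.H.is_group by blast
qed

end
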